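(* A cyclic Lagrangian surface of $\mathbb{C}^2$ may be locally parametrized, up to $U(2)$ congruence, by one of the following immersions $Y : I\times \mathbb{R}/2\pi\mathbb{Z}\to\mathbb{C}^2$ ($I\subset\mathbb{R}$ an interval, $s_0\in I$): Type I: $$Y(s,t)=r(s)e^{i\phi(s)}(\cos t,\sin t)+\int_{s_0}^s e^{i\phi(u)}(W_1(u),W_2(u))\,du,$$ where $r$ is a positive function, $\phi$ is a real-valued function, and $W_1,W_2$ are real-valued functions; in particular, when $\phi$ is constant, $Y$ stays within the Lagrangian plane $\mathrm{Span}_{\mathbb{R}}(e^{i\phi}(1,0),e^{i\phi}(0,1))$. Type II: $$Y(s,t)=c\,(\gamma_1(s)e^{it},\gamma_2(s)e^{it})+\int_{s_0}^s W(u)\,(\overline{\gamma_2}(u),-\overline{\gamma_1}(u))\,du,$$ where $\gamma=(\gamma_1,\gamma_2)$ is any Legendrian curve of $\mathbb{S}^3$, $c$ is a real constant and $W$ is a complex-valued function; in particular, if $\gamma$ is constant, then up to congruence we may assume $\gamma=(1,0)$ and the immersion becomes $Y(s,t)=(c\,e^{it},V_2(s))$ for some complex-valued function $V_2$, so that the immersed surface is a Cartesian product of a circle with a planar curve. Type III: $$Y(s,t)=c\,(\alpha_1(s)e^{it},\alpha_2(s)e^{-it})+\int_{s_0}^s \big(W(u)|\alpha_2(u)|^2,\ \overline{W}(u)\,\alpha_1(u)\alpha_2(u)\big)\,du,$$ where $\alpha=(\alpha_1,\alpha_2)$ is any Legendrian curve in the unit anti-De Sitter space $\mathbb{H}^3_1$,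 $c$ is a real constant and $W$ is a complex-valued function.
   Context: $\mathbb{C}^2\simeq\mathbb{R}^4$ carries its standard Euclidean inner product $\langle\cdot,\cdot\rangle$ and complex structure $J$ (multiplication by $i$), and $U(2)$ is the unitary group of $\mathbb{C}^2$; on $\mathbb{C}\simeq\mathbb{R}^2$, $\langle z,w\rangle=\mathrm{Re}(z\bar w)$. A surface is Lagrangian if $\langle v,Jw\rangle=0$ for all tangent vectors $v,w$ at the same point. A surface is cyclic if it is foliated by round circles (with possibly varying centers and radii); locally it is parametrized by an immersion $Y(s,t)=r(s)(e_1(s)\cos t+e_2(s)\sin t)+V(s)$, with $r>0$, $(e_1(s),e_2(s))$ an orthonormal pair in $\mathbb{R}^4$ and $V$ a $\mathbb{C}^2$-valued function. A curve $\gamma=(\gamma_1,\gamma_2)$ in the unit sphere $\mathbb{S}^3\subset\mathbb{C}^2$ is Legendrian if $\langle\gamma',J\gamma\rangle=0$; it need not be regular (it may be constant). The unit anti-De Sitter space is $\mathbb{H}^3_1=\{(\alpha_1,\alpha_2)\in\mathbb{C}^2 : |\alpha_1|^2-|\alpha_2|^2=-1\}$; a curve $\alpha=(\alpha_1,\alpha_2)$ in $\mathbb{H}^3_1$ is Legendrian if $\langle\alpha_1',i\alpha_1\rangle-\langle\alpha_2',i\alpha_2\rangle=0$. All objects are smooth.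
   Formalization: Congruence includes translations, as each model has center 0 at s_0; the local normal form is claimed off the boundary of the interior of the set of parameters whose circles lie in complex lines (an open dense set remains), since smooth surfaces can switch type at such boundary parameters. *)

theory Defs
  imports "HOL-Analysis.Analysis"
begin

text \<open>
  The product type \<open>complex \<times> complex\<close> carries the Euclidean inner product of \<open>\<real>\<^sup>4\<close>, and on
  \<^typ>\<open>complex\<close> we have \<open>z \<bullet> w = Re (z * cnj w)\<close>.
\<close>

type_synonym C2 = "complex \<times> complex"

definition cmul :: "complex \<Rightarrow> C2 \<Rightarrow> C2" where
  "cmul z v = (z * fst v, z * snd v)"

abbreviation J :: "C2 \<Rightarrow> C2" where
  "J \<equiv> cmul \<i>"

definition herm :: "C2 \<Rightarrow> C2 \<Rightarrow> complex" where
  "herm v w = fst v * cnj (fst w) + snd v * cnj (snd w)"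

definition unitary :: "(C2 \<Rightarrow> C2) \<Rightarrow> bool" where
  "unitary U \<longleftrightarrow>
     (\<forall>v w. U (v + w) = U v + U w) \<and>
     (\<forall>z v. U (cmul z v) = cmul z (U v)) \<and>
     (\<forall>v w. herm (U v) (U w) = herm v w)"

definition lagrangian_plane :: "C2 set \<Rightarrow> bool" where
  "lagrangian_plane P \<longleftrightarrow> subspace P \<and> dim P = 2 \<and> (\<forall>v\<in>P. \<forall>w\<in>P. v \<bullet> J w = 0)"

definition open_interval :: "real set \<Rightarrow> bool" where
  "open_interval I \<longleftrightarrow> open I \<and> is_interval I"

text \<open>Derivatives of all orders exist; only used on open sets.\<close>

definition smooth_on :: "real set \<Rightarrow> (real \<Rightarrow> 'a::real_normed_vector) \<Rightarrow> bool" where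
  "smooth_on S f \<longleftrightarrow>
     (\<forall>n. \<forall>s\<in>S. ((\<lambda>g s. vector_derivative g (at s)) ^^ n) f differentiable at s)"

text \<open>
  A map from \<open>I \<times> \<real>/2\<pi>\<int>\<close> is a map \<open>Y s t\<close> with \<open>s \<in> I\<close> that is \<open>2\<pi>\<close>-periodic in \<open>t\<close>;
  periodicity is automatic for all the maps below.  Values of \<open>Y\<close> for \<open>s \<notin> I\<close> are irrelevant.
\<close>

definition immersion_on :: "real set \<Rightarrow> (real \<Rightarrow> real \<Rightarrow> C2) \<Rightarrow> bool" where
  "immersion_on I Y \<longleftrightarrow>
     (\<forall>s\<in>I. \<forall>t. (\<lambda>(s, t). Y s t) differentiable at (s, t) \<and>
        inj (frechet_derivative (\<lambda>(s, t). Y s t) (at (s, t))))"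

definition lagrangian_on :: "real set \<Rightarrow> (real \<Rightarrow> real \<Rightarrow> C2) \<Rightarrow> bool" where
  "lagrangian_on I Y \<longleftrightarrow>
     (\<forall>s\<in>I. \<forall>t. \<forall>v w.
        frechet_derivative (\<lambda>(s, t). Y s t) (at (s, t)) v \<bullet>
          J (frechet_derivative (\<lambda>(s, t). Y s t) (at (s, t)) w) = 0)"

definition cyclic_immersion :: "real set \<Rightarrow> (real \<Rightarrow> real \<Rightarrow> C2) \<Rightarrow> bool" where
  "cyclic_immersion I Y \<longleftrightarrow> immersion_on I Y \<and>
     (\<exists>r e1 e2 V. smooth_on I r \<and> smooth_on I e1 \<and> smooth_on I e2 \<and> smooth_on I V \<and>
        (\<forall>s\<in>I. r s > 0 \<and> norm (e1 s) = 1 \<and> norm (e2 s) = 1 \<and> e1 s \<bullet> e2 s = 0) \<and>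
        (\<forall>s\<in>I. \<forall>t. Y s t = r s *\<^sub>R (cos t *\<^sub>R e1 s + sin t *\<^sub>R e2 s) + V s))"

definition legendrian_sphere :: "real set \<Rightarrow> (real \<Rightarrow> C2) \<Rightarrow> bool" where
  "legendrian_sphere I \<gamma> \<longleftrightarrow> smooth_on I \<gamma> \<and>
     (\<forall>s\<in>I. norm (\<gamma> s) = 1 \<and> vector_derivative \<gamma> (at s) \<bullet> J (\<gamma> s) = 0)"

definition legendrian_adS :: "real set \<Rightarrow> (real \<Rightarrow> C2) \<Rightarrow> bool" where
  "legendrian_adS I \<alpha> \<longleftrightarrow> smooth_on I \<alpha> \<and>
     (\<forall>s\<in>I. (cmod (fst (\<alpha> s)))\<^sup>2 - (cmod (snd (\<alpha> s)))\<^sup>2 = -1 \<and>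
        fst (vector_derivative \<alpha> (at s)) \<bullet> (\<i> * fst (\<alpha> s)) -
        snd (vector_derivative \<alpha> (at s)) \<bullet> (\<i> * snd (\<alpha> s)) = 0)"

text \<open>Interval integrals \<open>LBINT u=a..b\<close> are oriented, so \<open>s < s0\<close> is allowed.\<close>

definition map_I ::
    "real \<Rightarrow> (real \<Rightarrow> real) \<Rightarrow> (real \<Rightarrow> real) \<Rightarrow> (real \<Rightarrow> real) \<Rightarrow> (real \<Rightarrow> real)
      \<Rightarrow> real \<Rightarrow> real \<Rightarrow> C2" where
  "map_I s0 r \<phi> W1 W2 s t =
     cmul (of_real (r s) * cis (\<phi> s)) (of_real (cos t), of_real (sin t)) +
     (LBINT u=s0..s. cmul (cis (\<phi> u)) (of_real (W1 u), of_real (W2 u)))"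

definition map_II ::
    "real \<Rightarrow> real \<Rightarrow> (real \<Rightarrow> C2) \<Rightarrow> (real \<Rightarrow> complex) \<Rightarrow> real \<Rightarrow> real \<Rightarrow> C2" where
  "map_II s0 c \<gamma> W s t =
     c *\<^sub>R (fst (\<gamma> s) * cis t, snd (\<gamma> s) * cis t) +
     (LBINT u=s0..s. cmul (W u) (cnj (snd (\<gamma> u)), - cnj (fst (\<gamma> u))))"

definition map_III ::
    "real \<Rightarrow> real \<Rightarrow> (real \<Rightarrow> C2) \<Rightarrow> (real \<Rightarrow> complex) \<Rightarrow> real \<Rightarrow> real \<Rightarrow> C2" where
  "map_III s0 c \<alpha> W s t =
     c *\<^sub>R (fst (\<alpha> s) * cis t, snd (\<alpha> s) * cis (- t)) +
     (LBINT u=s0..s. (W u * of_real ((cmod (snd (\<alpha> u)))\<^sup>2),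
                      cnj (W u) * fst (\<alpha> u) * snd (\<alpha> u)))"

definition data_I ::
    "real set \<Rightarrow> real \<Rightarrow> (real \<Rightarrow> real) \<Rightarrow> (real \<Rightarrow> real) \<Rightarrow> (real \<Rightarrow> real) \<Rightarrow> (real \<Rightarrow> real) \<Rightarrow> bool"
  where
  "data_I I s0 r \<phi> W1 W2 \<longleftrightarrow> open_interval I \<and> s0 \<in> I \<and>
     smooth_on I r \<and> (\<forall>s\<in>I. r s > 0) \<and> smooth_on I \<phi> \<and> smooth_on I W1 \<and> smooth_on I W2 \<and>
     immersion_on I (map_I s0 r \<phi> W1 W2)"

definition data_II ::
    "real set \<Rightarrow> real \<Rightarrow> real \<Rightarrow> (real \<Rightarrow> C2) \<Rightarrow> (real \<Rightarrow> complex) \<Rightarrow> bool" where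
  "data_II I s0 c \<gamma> W \<longleftrightarrow> open_interval I \<and> s0 \<in> I \<and>
     legendrian_sphere I \<gamma> \<and> smooth_on I W \<and> immersion_on I (map_II s0 c \<gamma> W)"

definition data_III ::
    "real set \<Rightarrow> real \<Rightarrow> real \<Rightarrow> (real \<Rightarrow> C2) \<Rightarrow> (real \<Rightarrow> complex) \<Rightarrow> bool" where
  "data_III I s0 c \<alpha> W \<longleftrightarrow> open_interval I \<and> s0 \<in> I \<and>
     legendrian_adS I \<alpha> \<and> smooth_on I W \<and> immersion_on I (map_III s0 c \<alpha> W)"

text \<open>
  \<open>X\<close> and \<open>Y\<close> parametrize the same surface over \<open>I \<times> \<real>/2\<pi>\<int>\<close>, up to a unitary map and a translation:
  the circles of \<open>X\<close> go to those of \<open>Y\<close>, each with a rotated and possibly reversed parameter.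
  The translation is needed because the curve of centers of each model map vanishes at \<open>s0\<close>.
\<close>

definition congruent_on ::
    "real set \<Rightarrow> (real \<Rightarrow> real \<Rightarrow> C2) \<Rightarrow> (real \<Rightarrow> real \<Rightarrow> C2) \<Rightarrow> bool" where
  "congruent_on I X Y \<longleftrightarrow>
     (\<exists>U b \<theta> \<sigma>. unitary U \<and> smooth_on I \<theta> \<and> (\<sigma> = 1 \<or> \<sigma> = -1) \<and>
        (\<forall>s\<in>I. \<forall>t. U (X s t) + b = Y s (\<sigma> * t + \<theta> s)))"

text \<open>The parameters whose circle lies in a complex affine line.\<close>

definition complex_circles :: "real set \<Rightarrow> (real \<Rightarrow> real \<Rightarrow> C2) \<Rightarrow> real set" where
  "complex_circles I X = {s\<in>I. \<exists>p v. \<forall>t. \<exists>z. X s t = p + cmul z v}"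

text \<open>
  At the boundary of an open set of complex circles, a smooth cyclic Lagrangian surface may pass
  from circles spanning complex lines to circles whose planes are neither complex nor Lagrangian,
  and no single normal form need hold near such a parameter.  These parameters form a closed
  nowhere dense set; all the others are called generic.
\<close>

definition generic :: "real set \<Rightarrow> (real \<Rightarrow> real \<Rightarrow> C2) \<Rightarrow> real set" where
  "generic I X = I - frontier (interior (complex_circles I X))"

end

theory Submission
  imports Defs
begin

text \<open>
  Write a family of circles as \<open>e\<^sup>i\<^sup>t p(s) + e\<^sup>-\<^sup>i\<^sup>t q(s) + V(s)\<close> with curves \<open>p\<close>, \<open>q\<close>, \<open>V\<close> in two complex
  dimensions.  That its members are round circles means that \<open>p\<close> and \<open>q\<close> are Hermitian orthogonal.  The
  symplectic product of the two tangent vectors is a trigonometric polynomial in \<open>t\<close>; it vanishes iff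
  \<open>Re \<langle>p', p\<rangle> = Re \<langle>q', q\<rangle>\<close>, \<open>\<langle>p', q\<rangle> = \<langle>p, q'\<rangle>\<close> and \<open>\<langle>V', q\<rangle> = \<langle>p, V'\<rangle>\<close>
  (\<open>lagrangian_on_circles_iff\<close>).  Differentiating \<open>\<langle>p, q\<rangle> = 0\<close> shows that \<open>\<langle>p', q\<rangle>\<close> and \<open>\<langle>p, q'\<rangle>\<close> are
  also opposite, hence both zero.

  Two consequences govern the classification.  First, \<open>k = |q|\<^sup>2 - |p|\<^sup>2\<close> is constant
  (\<open>norm_difference_constant\<close>).  Secondly, in two complex dimensions the derivatives \<open>p'\<close> and \<open>q'\<close> are
  parallel to \<open>p\<close> and \<open>q\<close> wherever both are nonzero, so that \<open>p\<close> and \<open>q\<close> each stay on a fixed complex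
  line and the two lines may be taken as coordinate axes (\<open>fixed_lines\<close>).  A circle lies in a complex
  line exactly where \<open>p\<close> or \<open>q\<close> vanishes.  If one of them vanishes on an interval, say \<open>q\<close>, then \<open>p\<close>
  has constant length and is otherwise free to turn, which is the second normal form.  If the zeros
  are nowhere dense near a parameter, the fixed lines persist by continuity, and the surface has the
  first normal form for \<open>k = 0\<close> and the third for \<open>k \<noteq> 0\<close>, where the orientation is chosen with
  \<open>k > 0\<close>.  In each case the equation for \<open>V'\<close> is linear and its solutions are the integrands of
  the model.  The rotation of the circles absorbs the phase that the model normalizes: by the choice
  of arguments in the first form, and by solving an equation for the angular velocity so that the
  curve becomes Legendrian in the other two
  (\<open>reduce_to_map_I\<close>, \<open>reduce_to_map_II\<close>, \<open>reduce_to_map_III\<close>).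

  Conversely, each model is such a family and satisfies the three equations.
\<close>

section \<open>Calculus of smooth maps on open sets\<close>

text \<open>
  Closure properties of \<^const>\<open>smooth_on\<close> are awkward to prove from iterated derivatives, since
  the derivative of a product or a composition is not of the same shape.  With a bound on the
  number of derivatives they become inductions: the derivative of a product or composition of maps
  that are differentiable \<open>Suc n\<close> times is built from maps that are differentiable \<open>n\<close> times.
\<close>

primrec times_differentiable :: "nat \<Rightarrow> real set \<Rightarrow> (real \<Rightarrow> 'a::real_normed_vector) \<Rightarrow> bool" where
  "times_differentiable 0 S f \<longleftrightarrow> True"
| "times_differentiable (Suc n) S f \<longleftrightarrow>
     (\<exists>f'. (\<forall>s\<in>S. (f has_vector_derivative f' s) (at s)) \<and> times_differentiable n S f')"

lemma times_differentiable_cong: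
  assumes "open S" "\<And>s. s \<in> S \<Longrightarrow> f s = g s" "times_differentiable n S f"
  shows "times_differentiable n S g"
  using assms
  by (cases n) (auto, metis has_vector_derivative_transform_within_open)

lemma times_differentiable_mono:
  "times_differentiable (Suc n) S f \<Longrightarrow> times_differentiable n S f"
  by (induction n arbitrary: f) (simp, metis times_differentiable.simps(2))

lemma smooth_on_iff_times_differentiable:
  assumes "open S"
  shows "smooth_on S f \<longleftrightarrow> (\<forall>n. times_differentiable n S f)"
proof
  define D :: "(real \<Rightarrow> 'a) \<Rightarrow> real \<Rightarrow> 'a" where "D = (\<lambda>g s. vector_derivative g (at s))"
  show "\<forall>n. times_differentiable n S f" if "smooth_on S f"
  proof
    fix n
    have sm: "\<forall>n. \<forall>s\<in>S. (D ^^ n) f differentiable at s"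
      using that unfolding smooth_on_def D_def .
    show "times_differentiable n S f"
      using sm
    proof (induction n arbitrary: f)
      case (Suc n)
      have "times_differentiable n S (D f)"
        using Suc.prems by (intro Suc.IH) (metis funpow_Suc_right o_apply)
      moreover have "\<forall>s\<in>S. (f has_vector_derivative D f s) (at s)"
        using Suc.prems[rule_format, of _ 0] by (simp add: D_def vector_derivative_works)
      ultimately show ?case by auto
    qed simp
  qed
  show "smooth_on S f" if "\<forall>n. times_differentiable n S f"
  proof -
    have "\<forall>s\<in>S. (D ^^ n) f differentiable at s" if "times_differentiable (Suc n) S f" for n
      using that
    proof (induction n arbitrary: f)
      case 0
      then show ?case by (auto simp: differentiableI_vector)
    next
      case (Suc n)
      then obtain f' where f': "\<forall>s\<in>S. (f has_vector_derivative f' s) (at s)"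
        and td: "times_differentiable (Suc n) S f'" by (metis times_differentiable.simps(2))
      have "times_differentiable (Suc n) S (D f)"
        using f' by (intro times_differentiable_cong[OF assms _ td])
          (metis D_def vector_derivative_at)
      from Suc.IH[OF this] show ?case by (metis funpow_Suc_right o_apply)
    qed
    with that show ?thesis unfolding smooth_on_def D_def by blast
  qed
qed

lemma times_differentiable_const: "times_differentiable n S (\<lambda>_. c)"
  by (induction n arbitrary: c) (auto intro!: exI[of _ "\<lambda>_. 0"] derivative_intros)

lemma times_differentiable_add:
  "times_differentiable n S f \<Longrightarrow> times_differentiable n S g \<Longrightarrow>
   times_differentiable n S (\<lambda>s. f s + g s)"
proof (induction n arbitrary: f g)
  case (Suc n)
  then obtain f' g' where "\<forall>s\<in>S. (f has_vector_derivative f' s) (at s)"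
    "times_differentiable n S f'" "\<forall>s\<in>S. (g has_vector_derivative g' s) (at s)"
    "times_differentiable n S g'" by auto
  with Suc.IH[of f' g'] show ?case
    by (auto intro!: exI[of _ "\<lambda>s. f' s + g' s"] derivative_intros)
qed simp

lemma times_differentiable_linear:
  assumes L: "bounded_linear L"
  shows "times_differentiable n S f \<Longrightarrow> times_differentiable n S (\<lambda>s. L (f s))"
proof (induction n arbitrary: f)
  case (Suc n)
  then obtain f' where "\<forall>s\<in>S. (f has_vector_derivative f' s) (at s)"
    "times_differentiable n S f'" by auto
  with Suc.IH[of f'] show ?case
    by (auto intro!: exI[of _ "\<lambda>s. L (f' s)"] bounded_linear.has_vector_derivative[OF L])
qed simp

lemma times_differentiable_bilinear:
  assumes B: "bounded_bilinear B"
  shows "times_differentiable n S f \<Longrightarrow> times_differentiable n S g \<Longrightarrow>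
    times_differentiable n S (\<lambda>s. B (f s) (g s))"
proof (induction n arbitrary: f g)
  case (Suc n)
  then obtain f' g' where *: "\<forall>s\<in>S. (f has_vector_derivative f' s) (at s)"
    "times_differentiable n S f'" "\<forall>s\<in>S. (g has_vector_derivative g' s) (at s)"
    "times_differentiable n S g'" by auto
  have "times_differentiable n S f" "times_differentiable n S g"
    using Suc.prems by (blast intro: times_differentiable_mono)+
  with * have "times_differentiable n S (\<lambda>s. B (f s) (g' s) + B (f' s) (g s))"
    by (intro times_differentiable_add Suc.IH)
  with * show ?case
    by (auto intro!: exI[of _ "\<lambda>s. B (f s) (g' s) + B (f' s) (g s)"]
        bounded_bilinear.has_vector_derivative[OF B])
qed simp

text \<open>
  Exponential, inverse and square root have derivatives \<open>m\<close> that are algebraic expressions in the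
  functions themselves, so \<open>n\<close> derivatives of \<open>h \<circ> f\<close> give \<open>n\<close> derivatives of \<open>m \<circ> f\<close>.
\<close>

lemma times_differentiable_compose:
  fixes f :: "real \<Rightarrow> 'a::real_normed_field"
  assumes deriv: "\<And>z. z \<in> T \<Longrightarrow> (h has_field_derivative m z) (at z)"
    and T: "\<And>s. s \<in> S \<Longrightarrow> f s \<in> T"
    and m: "\<And>n. times_differentiable n S f \<Longrightarrow> times_differentiable n S (\<lambda>s. h (f s)) \<Longrightarrow>
      times_differentiable n S (\<lambda>s. m (f s))"
  shows "times_differentiable n S f \<Longrightarrow> times_differentiable n S (\<lambda>s. h (f s))"
proof (induction n)
  case (Suc n)
  then obtain f' where f': "\<forall>s\<in>S. (f has_vector_derivative f' s) (at s)"
    "times_differentiable n S f'" by auto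
  have "times_differentiable n S f" using Suc.prems by (rule times_differentiable_mono)
  then have "times_differentiable n S (\<lambda>s. f' s * m (f s))"
    by (intro times_differentiable_bilinear[OF bounded_bilinear_mult] f' m Suc.IH)
  moreover have "\<forall>s\<in>S. ((\<lambda>s. h (f s)) has_vector_derivative f' s * m (f s)) (at s)"
    using f' deriv T field_vector_diff_chain_at[unfolded o_def] by blast
  ultimately show ?case by (auto intro!: exI[of _ "\<lambda>s. f' s * m (f s)"])
qed simp

lemma times_differentiable_exp:
  fixes f :: "real \<Rightarrow> complex"
  shows "times_differentiable n S f \<Longrightarrow> times_differentiable n S (\<lambda>s. exp (f s))"
  by (rule times_differentiable_compose[where h = exp and f = f and T = UNIV and m = exp])
    (auto intro: DERIV_exp)

lemma times_differentiable_inverse: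
  fixes f :: "real \<Rightarrow> 'a::real_normed_field"
  assumes "\<And>s. s \<in> S \<Longrightarrow> f s \<noteq> 0"
  shows "times_differentiable n S f \<Longrightarrow> times_differentiable n S (\<lambda>s. inverse (f s))"
proof (rule times_differentiable_compose[where h = inverse and f = f and T = "- {0}"
      and m = "\<lambda>z. - (inverse z * inverse z)"])
  show "(inverse has_field_derivative - (inverse z * inverse z)) (at z)"
    if "z \<in> - {0}" for z :: 'a
    using DERIV_inverse[of z] that by (simp add: power2_eq_square)
  show "times_differentiable n S (\<lambda>s. - (inverse (f s) * inverse (f s)))"
    if "times_differentiable n S (\<lambda>s. inverse (f s))" for n
    by (rule times_differentiable_linear[OF bounded_linear_minus[OF bounded_linear_ident]],
        rule times_differentiable_bilinear[OF bounded_bilinear_mult that that])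
qed (use assms in auto)

lemma times_differentiable_sqrt:
  fixes f :: "real \<Rightarrow> real"
  assumes "\<And>s. s \<in> S \<Longrightarrow> f s > 0"
  shows "times_differentiable n S f \<Longrightarrow> times_differentiable n S (\<lambda>s. sqrt (f s))"
proof (rule times_differentiable_compose[where h = sqrt and f = f and T = "{0<..}"
      and m = "\<lambda>z. inverse (sqrt z) / 2"])
  show "times_differentiable n S (\<lambda>s. inverse (sqrt (f s)) / 2)"
    if "times_differentiable n S (\<lambda>s. sqrt (f s))" for n
    using times_differentiable_inverse[OF _ that] assms
    by (intro times_differentiable_linear[OF bounded_linear_divide]) force
  show "(sqrt has_field_derivative inverse (sqrt z) / 2) (at z)" if "z \<in> {0<..}" for z
    using DERIV_real_sqrt[of z] that by simp
qed (use assms in auto)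

named_theorems smooth_intros

context
  fixes S :: "real set"
  assumes S: "open S"
begin

lemma smooth_on_cong:
  "smooth_on S f \<Longrightarrow> (\<And>s. s \<in> S \<Longrightarrow> f s = g s) \<Longrightarrow> smooth_on S g"
  unfolding smooth_on_iff_times_differentiable[OF S] by (meson S times_differentiable_cong)

lemma smooth_on_const [smooth_intros]: "smooth_on S (\<lambda>_. c)"
  unfolding smooth_on_iff_times_differentiable[OF S] by (simp add: times_differentiable_const)

lemma smooth_on_add [smooth_intros]:
  "smooth_on S f \<Longrightarrow> smooth_on S g \<Longrightarrow> smooth_on S (\<lambda>s. f s + g s)"
  unfolding smooth_on_iff_times_differentiable[OF S] by (simp add: times_differentiable_add)

lemma smooth_on_linear:
  "bounded_linear L \<Longrightarrow> smooth_on S f \<Longrightarrow> smooth_on S (\<lambda>s. L (f s))"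
  unfolding smooth_on_iff_times_differentiable[OF S] by (simp add: times_differentiable_linear)

lemma smooth_on_bilinear:
  "bounded_bilinear B \<Longrightarrow> smooth_on S f \<Longrightarrow> smooth_on S g \<Longrightarrow> smooth_on S (\<lambda>s. B (f s) (g s))"
  unfolding smooth_on_iff_times_differentiable[OF S] by (simp add: times_differentiable_bilinear)

lemma smooth_on_exp [smooth_intros]:
  "smooth_on S f \<Longrightarrow> smooth_on S (\<lambda>s. exp (f s :: complex))"
  unfolding smooth_on_iff_times_differentiable[OF S] by (simp add: times_differentiable_exp)

lemma smooth_on_inverse [smooth_intros]:
  "smooth_on S f \<Longrightarrow> (\<And>s. s \<in> S \<Longrightarrow> f s \<noteq> 0) \<Longrightarrow>
   smooth_on S (\<lambda>s. inverse (f s :: 'a::real_normed_field))"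
  unfolding smooth_on_iff_times_differentiable[OF S] by (simp add: times_differentiable_inverse)

lemma smooth_on_sqrt [smooth_intros]:
  "smooth_on S f \<Longrightarrow> (\<And>s. s \<in> S \<Longrightarrow> f s > 0) \<Longrightarrow> smooth_on S (\<lambda>s. sqrt (f s))"
  unfolding smooth_on_iff_times_differentiable[OF S] by (simp add: times_differentiable_sqrt)

lemma smooth_on_mult [smooth_intros]:
  "smooth_on S f \<Longrightarrow> smooth_on S g \<Longrightarrow> smooth_on S (\<lambda>s. f s * g s :: 'a::real_normed_algebra)"
  by (rule smooth_on_bilinear[OF bounded_bilinear_mult])

lemma smooth_on_divide [smooth_intros]:
  "smooth_on S f \<Longrightarrow> smooth_on S g \<Longrightarrow> (\<And>s. s \<in> S \<Longrightarrow> g s \<noteq> 0) \<Longrightarrow>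
   smooth_on S (\<lambda>s. f s / g s :: 'a::real_normed_field)"
  unfolding divide_inverse by (intro smooth_intros)

lemma smooth_on_scaleR [smooth_intros]:
  "smooth_on S f \<Longrightarrow> smooth_on S g \<Longrightarrow> smooth_on S (\<lambda>s. f s *\<^sub>R g s)"
  by (rule smooth_on_bilinear[OF bounded_bilinear_scaleR])

lemma smooth_on_minus [smooth_intros]: "smooth_on S f \<Longrightarrow> smooth_on S (\<lambda>s. - f s)"
  by (rule smooth_on_linear[OF bounded_linear_minus[OF bounded_linear_ident]])

lemma smooth_on_diff [smooth_intros]:
  "smooth_on S f \<Longrightarrow> smooth_on S g \<Longrightarrow> smooth_on S (\<lambda>s. f s - g s)"
  using smooth_on_add[of f "\<lambda>s. - g s"] smooth_on_minus[of g] by simp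

lemma smooth_on_fst [smooth_intros]: "smooth_on S f \<Longrightarrow> smooth_on S (\<lambda>s. fst (f s))"
  by (rule smooth_on_linear[OF bounded_linear_fst])

lemma smooth_on_snd [smooth_intros]: "smooth_on S f \<Longrightarrow> smooth_on S (\<lambda>s. snd (f s))"
  by (rule smooth_on_linear[OF bounded_linear_snd])

lemma smooth_on_Pair [smooth_intros]:
  assumes "smooth_on S f" "smooth_on S g"
  shows "smooth_on S (\<lambda>s. (f s, g s))"
proof -
  have "smooth_on S (\<lambda>s. (f s, 0) + (0, g s))"
    by (intro smooth_on_add assms
        smooth_on_linear[OF bounded_linear_Pair[OF bounded_linear_ident bounded_linear_zero]]
        smooth_on_linear[OF bounded_linear_Pair[OF bounded_linear_zero bounded_linear_ident]])
  then show ?thesis by simp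
qed

lemma smooth_on_cnj [smooth_intros]: "smooth_on S f \<Longrightarrow> smooth_on S (\<lambda>s. cnj (f s))"
  by (rule smooth_on_linear[OF bounded_linear_cnj])

lemma smooth_on_of_real [smooth_intros]:
  "smooth_on S f \<Longrightarrow> smooth_on S (\<lambda>s. of_real (f s) :: complex)"
  by (rule smooth_on_linear[OF bounded_linear_of_real])

lemma smooth_on_Re [smooth_intros]: "smooth_on S f \<Longrightarrow> smooth_on S (\<lambda>s. Re (f s))"
  by (rule smooth_on_linear[OF bounded_linear_Re])

lemma smooth_on_Im [smooth_intros]: "smooth_on S f \<Longrightarrow> smooth_on S (\<lambda>s. Im (f s))"
  by (rule smooth_on_linear[OF bounded_linear_Im])

lemma smooth_on_cis [smooth_intros]: "smooth_on S f \<Longrightarrow> smooth_on S (\<lambda>s. cis (f s))"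
  unfolding cis_conv_exp by (intro smooth_intros)

lemma smooth_on_cmul [smooth_intros]:
  "smooth_on S f \<Longrightarrow> smooth_on S g \<Longrightarrow> smooth_on S (\<lambda>s. cmul (f s) (g s))"
  unfolding cmul_def by (intro smooth_intros)

lemma smooth_on_herm [smooth_intros]:
  "smooth_on S f \<Longrightarrow> smooth_on S g \<Longrightarrow> smooth_on S (\<lambda>s. herm (f s) (g s))"
  unfolding herm_def by (intro smooth_intros)

lemma smooth_on_derivative:
  assumes "smooth_on S f"
  obtains f' where "smooth_on S f'" "\<And>s. s \<in> S \<Longrightarrow> (f has_vector_derivative f' s) (at s)"
proof
  show "smooth_on S (\<lambda>s. vector_derivative f (at s))"
    using assms unfolding smooth_on_def
    by (metis (no_types, lifting) funpow_Suc_right o_apply)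
  show "(f has_vector_derivative vector_derivative f (at s)) (at s)" if "s \<in> S" for s
    using assms that unfolding smooth_on_def
    by (metis funpow_0 vector_derivative_works)
qed

lemma smooth_onI:
  assumes "smooth_on S f'" "\<And>s. s \<in> S \<Longrightarrow> (f has_vector_derivative f' s) (at s)"
  shows "smooth_on S f"
  unfolding smooth_on_iff_times_differentiable[OF S]
proof
  show "times_differentiable n S f" for n
    using assms unfolding smooth_on_iff_times_differentiable[OF S] by (cases n) auto
qed

lemma smooth_on_imp_continuous_on: "smooth_on S f \<Longrightarrow> continuous_on S f"
  by (metis smooth_on_derivative continuous_at_imp_continuous_on
      has_vector_derivative_continuous)

end

lemma smooth_on_subset: "smooth_on S f \<Longrightarrow> T \<subseteq> S \<Longrightarrow> smooth_on T f"
  unfolding smooth_on_def by blast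

text \<open>
  The fundamental theorem holds within a compact interval; one that has \<open>a\<close> and \<open>s\<close> in its interior
  gives the two-sided derivative, in either order of \<open>a\<close> and \<open>s\<close>.
\<close>

lemma has_vector_derivative_LBINT:
  fixes f :: "real \<Rightarrow> 'a::euclidean_space"
  assumes I: "open_interval I" "a \<in> I" "s \<in> I" and f: "continuous_on I f"
  shows "((\<lambda>s. LBINT u=a..s. f u) has_vector_derivative f s) (at s)"
proof -
  have op: "open I" and int: "is_interval I" using I by (auto simp: open_interval_def)
  have "min a s \<in> I" "max a s \<in> I" using I by (auto simp: min_def max_def)
  obtain \<delta> where \<delta>: "0 < \<delta>" "cball (min a s) \<delta> \<subseteq> I"
    using op \<open>min a s \<in> I\<close> by (meson open_contains_cball)
  obtain \<epsilon> where \<epsilon>: "0 < \<epsilon>" "cball (max a s) \<epsilon> \<subseteq> I"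
    using op \<open>max a s \<in> I\<close> by (meson open_contains_cball)
  define d e where "d = min a s - \<delta>" and "e = max a s + \<epsilon>"
  have "d \<in> cball (min a s) \<delta>" "e \<in> cball (max a s) \<epsilon>"
    using \<delta>(1) \<epsilon>(1) by (simp_all add: d_def e_def dist_real_def)
  then have de: "d \<in> I" "e \<in> I" using \<delta>(2) \<epsilon>(2) by auto
  have d: "d < min a s" and e: "max a s < e"
    unfolding d_def e_def using \<delta>(1) \<epsilon>(1) by (auto simp: min_def max_def)
  have "{d..e} \<subseteq> I"
  proof
    fix x assume "x \<in> {d..e}"
    with de int show "x \<in> I" unfolding is_interval_1 by (metis atLeastAtMost_iff)
  qed
  then have "((\<lambda>s. LBINT u=a..s. f u) has_vector_derivative f s) (at s within {d..e})"
    using d e by (intro interval_integral_FTC2 continuous_on_subset[OF f]) auto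
  with d e show ?thesis
    by (simp add: at_within_Icc_at)
qed

lemma LBINT_eq_diff:
  fixes f :: "real \<Rightarrow> 'a::euclidean_space"
  assumes I: "open_interval I" "a \<in> I" "s \<in> I" and f: "continuous_on I f"
    and F: "\<And>u. u \<in> I \<Longrightarrow> (F has_vector_derivative f u) (at u)"
  shows "(LBINT u=a..s. f u) = F s - F a"
proof -
  have "min a s \<in> I" "max a s \<in> I" using I by (auto simp: min_def max_def)
  then have sub: "{min a s..max a s} \<subseteq> I"
    using I(1) unfolding open_interval_def is_interval_1 by (meson atLeastAtMost_iff subsetI)
  show ?thesis
  proof (rule interval_integral_FTC_finite)
    show "continuous_on {min a s..max a s} f" using f sub by (rule continuous_on_subset)
    show "(F has_vector_derivative f u) (at u within {min a s..max a s})"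
      if "min a s \<le> u" "u \<le> max a s" for u
      using sub that by (meson F atLeastAtMost_iff has_vector_derivative_at_within subset_iff)
  qed
qed

lemma smooth_on_LBINT:
  fixes f :: "real \<Rightarrow> 'a::euclidean_space"
  assumes I: "open_interval I" "a \<in> I" and f: "smooth_on I f"
  shows "smooth_on I (\<lambda>s. LBINT u=a..s. f u)"
proof -
  have op: "open I" using I by (simp add: open_interval_def)
  show ?thesis
    using smooth_on_imp_continuous_on[OF op f]
    by (intro smooth_onI[OF op f] has_vector_derivative_LBINT[OF I])
qed

lemma smooth_antiderivative:
  fixes f :: "real \<Rightarrow> 'a::euclidean_space"
  assumes I: "open_interval I" and f: "smooth_on I f"
  obtains F where "smooth_on I F" "\<And>s. s \<in> I \<Longrightarrow> (F has_vector_derivative f s) (at s)"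
proof (cases "I = {}")
  case True
  with that show ?thesis by (auto simp: smooth_on_def)
next
  case False
  then obtain a where a: "a \<in> I" by blast
  have "open I" using I by (simp add: open_interval_def)
  then show ?thesis
    using that[OF smooth_on_LBINT[OF I a f]]
      has_vector_derivative_LBINT[OF I a _ smooth_on_imp_continuous_on[OF _ f]] by blast
qed

lemma constant_if_derivative_zero:
  assumes I: "open_interval I"
    and f: "\<And>s. s \<in> I \<Longrightarrow> (f has_vector_derivative 0) (at s)" and ab: "a \<in> I" "b \<in> I"
  shows "f a = f b"
proof -
  have "convex I" using I by (simp add: open_interval_def is_interval_convex)
  moreover have "(f has_derivative (\<lambda>_. 0)) (at s within I)" if "s \<in> I" for s
    using f[OF that] by (simp add: has_vector_derivative_def has_derivative_at_withinI)
  ultimately have "\<exists>c. \<forall>s\<in>I. f s = c"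
    by (rule has_derivative_zero_constant)
  with ab show ?thesis by auto
qed

section \<open>Hermitian algebra on the complex plane squared\<close>

lemma herm_add_left: "herm (u + v) w = herm u w + herm v w"
  and herm_add_right: "herm w (u + v) = herm w u + herm w v"
  and herm_diff_left: "herm (u - v) w = herm u w - herm v w"
  and herm_diff_right: "herm w (u - v) = herm w u - herm w v"
  and herm_cmul_left: "herm (cmul z v) w = z * herm v w"
  and herm_cmul_right: "herm v (cmul z w) = cnj z * herm v w"
  and herm_scaleR_left: "herm (a *\<^sub>R v) w = of_real a * herm v w"
  and herm_scaleR_right: "herm v (a *\<^sub>R w) = of_real a * herm v w"
  and herm_zero_left: "herm 0 w = 0"
  and herm_zero_right: "herm w 0 = 0"
  by (simp_all add: herm_def cmul_def algebra_simps scaleR_conv_of_real)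

lemmas herm_simps = herm_add_left herm_add_right herm_diff_left herm_diff_right herm_cmul_left
  herm_cmul_right herm_scaleR_left herm_scaleR_right herm_zero_left herm_zero_right

lemma cnj_herm: "cnj (herm v w) = herm w v"
  by (simp add: herm_def)

lemma inner_eq_Re_herm: "v \<bullet> w = Re (herm v w)"
  by (simp add: herm_def inner_prod_def inner_complex_def)

lemma herm_self: "herm v v = of_real ((norm v)\<^sup>2)"
proof -
  have "Im (herm v v) = 0" by (simp add: herm_def)
  moreover have "Re (herm v v) = (norm v)\<^sup>2"
    by (metis inner_eq_Re_herm power2_norm_eq_inner)
  ultimately show ?thesis by (simp add: complex_eq_iff)
qed

lemma herm_self_eq_0_iff: "herm v v = 0 \<longleftrightarrow> v = 0"
  by (simp add: herm_self)

lemma cmul_cmul: "cmul z (cmul w v) = cmul (z * w) v"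
  by (simp add: cmul_def mult.assoc)

lemma cmul_add_right: "cmul z (v + w) = cmul z v + cmul z w"
  and cmul_scaleR_right: "cmul z (a *\<^sub>R v) = a *\<^sub>R cmul z v"
  and cmul_zero_right: "cmul z 0 = 0"
  and cmul_one: "cmul 1 v = v"
  by (simp_all add: cmul_def algebra_simps zero_prod_def)

lemma cmul_eq_0_iff: "cmul z v = 0 \<longleftrightarrow> z = 0 \<or> v = 0"
  by (auto simp: cmul_def prod_eq_iff)

lemma bounded_bilinear_cmul: "bounded_bilinear cmul"
proof
  show "\<exists>K. \<forall>z v. norm (cmul z v) \<le> norm z * norm v * K"
  proof (intro exI allI)
    fix z :: complex and v :: C2
    have "(norm (cmul z v))\<^sup>2 = (norm z * norm v)\<^sup>2"
    proof -
      have "of_real ((norm (cmul z v))\<^sup>2) = z * cnj z * of_real ((norm v)\<^sup>2)"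
        unfolding herm_self[symmetric] by (simp add: herm_simps)
      also have "\<dots> = of_real ((norm z * norm v)\<^sup>2)"
        using complex_norm_square[of z] by (simp add: power_mult_distrib)
      finally show ?thesis by (simp only: of_real_eq_iff)
    qed
    then have "norm (cmul z v) = norm z * norm v"
      by (simp add: power2_eq_iff_nonneg)
    then show "norm (cmul z v) \<le> norm z * norm v * 1" by simp
  qed
qed (simp_all add: cmul_def algebra_simps)

text \<open>The Hermitian orthogonal complement of \<open>w\<close> has complex dimension one.\<close>

lemma parallel_if_orthogonal:
  assumes "herm u w = 0" "herm v w = 0" "w \<noteq> 0"
  shows "fst u * snd v = snd u * fst v"
proof -
  have 1: "fst u * cnj (fst w) + snd u * cnj (snd w) = 0"
    and 2: "fst v * cnj (fst w) + snd v * cnj (snd w) = 0"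
    using assms by (auto simp: herm_def)
  have "cnj (fst w) * (fst u * snd v - snd u * fst v) = 0"
    using 1 2 by algebra
  moreover have "cnj (snd w) * (fst u * snd v - snd u * fst v) = 0"
    using 1 2 by algebra
  ultimately show ?thesis
    using assms(3) by (auto simp: prod_eq_iff)
qed

text \<open>The vector completing a unit vector to a unitary basis; it occurs in the second normal form.\<close>

definition perp :: "C2 \<Rightarrow> C2" where
  "perp v = (cnj (snd v), - cnj (fst v))"

lemma herm_perp [simp]: "herm v (perp v) = 0" "herm (perp v) v = 0"
  by (simp_all add: herm_def perp_def)

lemma norm_perp [simp]: "norm (perp v) = norm v"
  by (simp add: perp_def norm_prod_def add.commute)

lemma orthonormal_expansion:
  assumes "norm u = 1"
  shows "cmul (herm v u) u + cmul (herm v (perp u)) (perp u) = v"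
proof -
  have *: "fst u * cnj (fst u) + snd u * cnj (snd u) = 1"
    using herm_self[of u] assms by (simp add: herm_def)
  have "herm v u * fst u + herm v (perp u) * cnj (snd u) =
      fst v * (fst u * cnj (fst u) + snd u * cnj (snd u))"
    by (simp add: herm_def perp_def algebra_simps)
  moreover have "herm v u * snd u - herm v (perp u) * cnj (fst u) =
      snd v * (fst u * cnj (fst u) + snd u * cnj (snd u))"
    by (simp add: herm_def perp_def algebra_simps)
  ultimately show ?thesis
    by (simp add: * prod_eq_iff cmul_def) (simp add: perp_def)
qed

lemma unitaryD:
  assumes "unitary U"
  shows unitary_add: "U (v + w) = U v + U w"
    and unitary_cmul: "U (cmul z v) = cmul z (U v)"
    and unitary_herm: "herm (U v) (U w) = herm v w"
  using assms unfolding unitary_def by blast+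

lemma unitary_id: "unitary (\<lambda>v. v)"
  by (simp add: unitary_def)

lemma unitary_compose: "unitary U \<Longrightarrow> unitary U' \<Longrightarrow> unitary (\<lambda>v. U (U' v))"
  unfolding unitary_def by metis

lemma unitary_norm: "unitary U \<Longrightarrow> norm (U v) = norm v"
  using herm_self[of "U v"] herm_self[of v]
  by (metis norm_ge_zero of_real_eq_iff power2_eq_iff_nonneg unitary_herm)

lemma unitary_eq_0_iff: "unitary U \<Longrightarrow> U v = 0 \<longleftrightarrow> v = 0"
  by (metis norm_eq_zero unitary_norm)

lemma unitary_bounded_linear:
  assumes U: "unitary U"
  shows "bounded_linear U"
proof (rule bounded_linear_intro[where K = 1])
  show "U (v + w) = U v + U w" for v w by (rule unitary_add[OF U])
  show "U (a *\<^sub>R v) = a *\<^sub>R U v" for a v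
    using unitary_cmul[OF U, of "of_real a" v] by (simp add: cmul_def scaleR_prod_def scaleR_conv_of_real)
  show "norm (U v) \<le> norm v * 1" for v by (simp add: unitary_norm[OF U])
qed

lemma unitary_rows:
  assumes "norm u = 1"
  shows "unitary (\<lambda>v. (herm v u, herm v (perp u)))"
    and "unitary (\<lambda>v. (herm v (perp u), herm v u))"
proof -
  have parseval: "herm v u * cnj (herm w u) + herm v (perp u) * cnj (herm w (perp u)) = herm v w"
    for v w
  proof -
    have "herm v w = herm (cmul (herm v u) u + cmul (herm v (perp u)) (perp u)) w"
      by (simp only: orthonormal_expansion[OF assms])
    then show ?thesis by (simp add: herm_simps cnj_herm)
  qed
  have pair: "herm (a, b) (c, d) = a * cnj c + b * cnj d" for a b c d
    by (simp add: herm_def)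
  have cmul_pair: "cmul z (a, b) = (z * a, z * b)" for z a b by (simp add: cmul_def)
  show "unitary (\<lambda>v. (herm v u, herm v (perp u)))"
    unfolding unitary_def pair parseval cmul_pair by (simp add: herm_simps)
  show "unitary (\<lambda>v. (herm v (perp u), herm v u))"
    unfolding unitary_def pair cmul_pair using parseval by (simp add: herm_simps add.commute)
qed

section \<open>Families of circles in complex form\<close>

text \<open>
  With \<open>p = (a - i b) / 2\<close> and \<open>q = (a + i b) / 2\<close> the circle
  \<open>a cos t + b sin t + V\<close> becomes \<open>e\<^sup>i\<^sup>t p + e\<^sup>-\<^sup>i\<^sup>t q + V\<close>.  The vectors \<open>a\<close>, \<open>b\<close> are orthogonal of
  equal length iff \<open>p\<close>, \<open>q\<close> are orthogonal for the Hermitian product, the circle lies in a complex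
  line iff \<open>p\<close> or \<open>q\<close> vanishes, and reversing the circle exchanges \<open>p\<close> and \<open>q\<close>.
\<close>

definition circle_family :: "(real \<Rightarrow> C2) \<Rightarrow> (real \<Rightarrow> C2) \<Rightarrow> (real \<Rightarrow> C2) \<Rightarrow> real \<Rightarrow> real \<Rightarrow> C2" where
  "circle_family p q V s t = cmul (cis t) (p s) + cmul (cis (- t)) (q s) + V s"

lemma circle_family_real_form:
  "circle_family p q V s t = cos t *\<^sub>R (p s + q s) + sin t *\<^sub>R J (p s - q s) + V s"
  by (simp add: circle_family_def cmul_def prod_eq_iff complex_eq_iff algebra_simps)

lemma circle_family_flip: "circle_family q p V s t = circle_family p q V s (- t)"
  by (simp add: circle_family_def)

abbreviation vd :: "(real \<Rightarrow> 'a::real_normed_vector) \<Rightarrow> real \<Rightarrow> 'a" where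
  "vd f s \<equiv> vector_derivative f (at s)"

text \<open>
  The tangent vectors of a family of circles, given the derivatives \<open>p'\<close>, \<open>q'\<close>, \<open>V'\<close> of
  \<open>p\<close>, \<open>q\<close>, \<open>V\<close> at a parameter.
\<close>

definition tangent_s :: "C2 \<Rightarrow> C2 \<Rightarrow> C2 \<Rightarrow> real \<Rightarrow> C2" where
  "tangent_s p' q' V' t = cmul (cis t) p' + cmul (cis (- t)) q' + V'"

definition tangent_t :: "C2 \<Rightarrow> C2 \<Rightarrow> real \<Rightarrow> C2" where
  "tangent_t p q t = J (cmul (cis t) p - cmul (cis (- t)) q)"

lemma has_derivative_circle_family:
  assumes p: "(p has_vector_derivative p') (at s)" and q: "(q has_vector_derivative q') (at s)"
    and V: "(V has_vector_derivative V') (at s)"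
  shows "((\<lambda>(s, t). circle_family p q V s t) has_derivative
      (\<lambda>v. fst v *\<^sub>R tangent_s p' q' V' t + snd v *\<^sub>R tangent_t (p s) (q s) t)) (at (s, t))"
proof -
  have comp: "((\<lambda>x. f (fst x)) has_derivative (\<lambda>v. fst v *\<^sub>R f')) (at (s, t))"
    if "(f has_vector_derivative f') (at s)" for f :: "real \<Rightarrow> C2" and f'
    using has_derivative_compose[OF bounded_linear_imp_has_derivative[OF bounded_linear_fst],
        of f "\<lambda>h. h *\<^sub>R f'" "(s, t)"] that
    by (simp add: has_vector_derivative_def)
  have c: "((\<lambda>x. cis (snd x)) has_derivative (\<lambda>v. snd v *\<^sub>R (\<i> * cis t))) (at (s, t))"
    by (rule has_derivative_eq_rhs[OF has_derivative_cis])
      (auto intro!: derivative_eq_intros simp: fun_eq_iff)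
  have c': "((\<lambda>x. cis (- snd x)) has_derivative (\<lambda>v. - snd v *\<^sub>R (\<i> * cis (- t)))) (at (s, t))"
    by (rule has_derivative_eq_rhs[OF has_derivative_cis])
      (auto intro!: derivative_eq_intros simp: fun_eq_iff)
  have "((\<lambda>x. cmul (cis (snd x)) (p (fst x)) + cmul (cis (- snd x)) (q (fst x)) + V (fst x))
      has_derivative (\<lambda>v. cmul (cis t) (fst v *\<^sub>R p') + cmul (snd v *\<^sub>R (\<i> * cis t)) (p s)
        + (cmul (cis (- t)) (fst v *\<^sub>R q') + cmul (- snd v *\<^sub>R (\<i> * cis (- t))) (q s))
        + fst v *\<^sub>R V')) (at (s, t))"
    using bounded_bilinear.FDERIV[OF bounded_bilinear_cmul c comp[OF p]]
      bounded_bilinear.FDERIV[OF bounded_bilinear_cmul c' comp[OF q]] comp[OF V]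
    by (intro has_derivative_add) simp_all
  then show ?thesis
    unfolding circle_family_def case_prod_unfold
    by (rule has_derivative_eq_rhs)
      (simp add: fun_eq_iff tangent_s_def tangent_t_def cmul_def prod_eq_iff algebra_simps)
qed

text \<open>
  The symplectic product of the two tangent vectors is a trigonometric polynomial in \<open>t\<close>, whose
  coefficients must all vanish.
\<close>

lemma trigonometric_polynomial_zero:
  "(\<forall>t. Re (A * cis (2 * t)) + Re (B * cis t) + c = 0) \<longleftrightarrow> A = 0 \<and> B = 0 \<and> c = 0"
proof
  assume *: "\<forall>t. Re (A * cis (2 * t)) + Re (B * cis t) + c = 0"
  have "Re A + Re B + c = 0" using *[rule_format, of 0] by simp
  moreover have "Re A - Re B + c = 0" using *[rule_format, of pi] by simp
  moreover have "- Re A - Im B + c = 0" using *[rule_format, of "pi/2"] by simp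
  moreover have "- Re A + Im B + c = 0" using *[rule_format, of "-(pi/2)"] by simp
  ultimately have B: "B = 0" "Re A = 0" "c = 0" by (auto simp: complex_eq_iff)
  moreover have "Im A = 0" using *[rule_format, of "pi/4"] B by simp
  ultimately show "A = 0 \<and> B = 0 \<and> c = 0" by (simp add: complex_eq_iff)
qed simp

lemma tangents_symplectic_orthogonal_iff:
  "(\<forall>t. tangent_s p' q' V' t \<bullet> J (tangent_t p q t) = 0) \<longleftrightarrow>
    Re (herm p' p) = Re (herm q' q) \<and> herm p' q = herm p q' \<and> herm V' q = herm p V'"
proof -
  have "tangent_s p' q' V' t \<bullet> J (tangent_t p q t) =
      Re ((herm p' q - herm p q') * cis (2 * t)) + Re ((herm V' q - herm p V') * cis t)
      + (Re (herm q' q) - Re (herm p' p))" for t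
  proof -
    have e: "cis t * cis t = cis (2 * t)" "cis t * cis (- t) = 1" "cis (- t) * cis t = 1"
      "cis (- t) * cis (- t) = cnj (cis (2 * t))"
      by (simp_all add: cis_mult cis_cnj)
    have "herm (tangent_s p' q' V' t) (J (tangent_t p q t)) =
       (cis t * cis t) * herm p' q - (cis t * cis (- t)) * herm p' p
       + (cis (- t) * cis t) * herm q' q - (cis (- t) * cis (- t)) * herm q' p
       + cis t * herm V' q - cis (- t) * herm V' p"
      by (simp add: tangent_s_def tangent_t_def herm_simps cis_cnj algebra_simps)
    also have "\<dots> = cis (2 * t) * herm p' q - herm p' p + herm q' q - cnj (cis (2 * t) * herm p q')
       + cis t * herm V' q - cnj (cis t * herm p V')"
      unfolding e by (simp add: cnj_herm cis_cnj)
    finally have "Re (herm (tangent_s p' q' V' t) (J (tangent_t p q t))) =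
       Re (cis (2 * t) * herm p' q) - Re (herm p' p) + Re (herm q' q)
       - Re (cis (2 * t) * herm p q') + Re (cis t * herm V' q) - Re (cis t * herm p V')"
      by (simp only: minus_complex.sel plus_complex.sel cnj.sel(1))
    then show ?thesis
      unfolding inner_eq_Re_herm left_diff_distrib minus_complex.sel
      by (simp only: mult.commute[of _ "cis t"] mult.commute[of _ "cis (2 * t)"])
  qed
  then show ?thesis by (simp only: trigonometric_polynomial_zero right_minus_eq) auto
qed

section \<open>Cyclic Lagrangian immersions in complex form\<close>

lemma has_vector_derivative_vd:
  assumes "open S" "smooth_on S f" "s \<in> S"
  shows "(f has_vector_derivative vd f s) (at s)"
  using assms by (metis smooth_on_derivative vector_derivative_at)

lemma smooth_on_vd:
  assumes "open S" "smooth_on S f"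
  shows "smooth_on S (\<lambda>s. vd f s)"
proof -
  obtain f' where f': "smooth_on S f'" "\<And>s. s \<in> S \<Longrightarrow> (f has_vector_derivative f' s) (at s)"
    using smooth_on_derivative[OF assms] by blast
  show ?thesis
    by (rule smooth_on_cong[OF assms(1) f'(1)]) (rule vector_derivative_at[symmetric, OF f'(2)])
qed

lemma has_derivative_circles:
  assumes I: "open I" and sm: "smooth_on I p" "smooth_on I q" "smooth_on I V"
    and X: "\<And>s t. s \<in> I \<Longrightarrow> X s t = circle_family p q V s t" and s: "s \<in> I"
  shows "((\<lambda>(s, t). X s t) has_derivative
      (\<lambda>v. fst v *\<^sub>R tangent_s (vd p s) (vd q s) (vd V s) t + snd v *\<^sub>R tangent_t (p s) (q s) t))
      (at (s, t))"
proof (rule has_derivative_transform_within_open[where s = "I \<times> UNIV"])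
  show "((\<lambda>(s, t). circle_family p q V s t) has_derivative
      (\<lambda>v. fst v *\<^sub>R tangent_s (vd p s) (vd q s) (vd V s) t + snd v *\<^sub>R tangent_t (p s) (q s) t))
      (at (s, t))"
    using sm has_vector_derivative_vd[OF I _ s] by (intro has_derivative_circle_family) blast+
  show "open (I \<times> UNIV :: (real \<times> real) set)" using I by (simp add: open_Times)
qed (use X s in auto)

lemma inner_J: "v \<bullet> J v = 0" "w \<bullet> J v = - (v \<bullet> J w)"
proof -
  show "v \<bullet> J v = 0" by (simp add: inner_eq_Re_herm herm_simps herm_self)
  show "w \<bullet> J v = - (v \<bullet> J w)"
    using cnj_herm[of v w] by (simp add: inner_eq_Re_herm herm_simps complex_eq_iff)
qed

lemma lagrangian_on_circles_iff:
  assumes "open I" "smooth_on I p" "smooth_on I q" "smooth_on I V"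
    "\<And>s t. s \<in> I \<Longrightarrow> X s t = circle_family p q V s t"
  shows "lagrangian_on I X \<longleftrightarrow> (\<forall>s\<in>I. Re (herm (vd p s) (p s)) = Re (herm (vd q s) (q s)) \<and>
    herm (vd p s) (q s) = herm (p s) (vd q s) \<and> herm (vd V s) (q s) = herm (p s) (vd V s))"
proof -
  have span: "(\<forall>v w. (fst v *\<^sub>R S + snd v *\<^sub>R T) \<bullet> J (fst w *\<^sub>R S + snd w *\<^sub>R T) = 0)
      \<longleftrightarrow> S \<bullet> J T = 0" for S T :: C2
  proof
    assume "\<forall>v w :: real \<times> real.
      (fst v *\<^sub>R S + snd v *\<^sub>R T) \<bullet> J (fst w *\<^sub>R S + snd w *\<^sub>R T) = 0"
    from this[rule_format, of "(1, 0)" "(0, 1)"] show "S \<bullet> J T = 0" by simp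
  next
    assume "S \<bullet> J T = 0"
    then show "\<forall>v w :: real \<times> real.
      (fst v *\<^sub>R S + snd v *\<^sub>R T) \<bullet> J (fst w *\<^sub>R S + snd w *\<^sub>R T) = 0"
      by (simp add: cmul_add_right cmul_scaleR_right inner_add_left inner_add_right inner_J(1)
          inner_J(2)[of T S])
  qed
  have "frechet_derivative (\<lambda>(s, t). X s t) (at (s, t)) =
      (\<lambda>v. fst v *\<^sub>R tangent_s (vd p s) (vd q s) (vd V s) t + snd v *\<^sub>R tangent_t (p s) (q s) t)"
    if "s \<in> I" for s t
    using has_derivative_circles[OF assms that] by (rule frechet_derivative_at[symmetric])
  then have "lagrangian_on I X \<longleftrightarrow> (\<forall>s\<in>I. \<forall>t.
      tangent_s (vd p s) (vd q s) (vd V s) t \<bullet> J (tangent_t (p s) (q s) t) = 0)"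
    unfolding lagrangian_on_def by (simp only: span cong: ball_cong)
  then show ?thesis by (simp only: tangents_symplectic_orthogonal_iff)
qed

lemma immersion_circles_nonzero:
  assumes "immersion_on I X" and "open I" "smooth_on I p" "smooth_on I q" "smooth_on I V"
    "\<And>s t. s \<in> I \<Longrightarrow> X s t = circle_family p q V s t" and s: "s \<in> I"
  shows "p s \<noteq> 0 \<or> q s \<noteq> 0"
proof (rule ccontr)
  assume *: "\<not> (p s \<noteq> 0 \<or> q s \<noteq> 0)"
  let ?D = "frechet_derivative (\<lambda>(s, t). X s t) (at (s, 0))"
  have "?D = (\<lambda>v. fst v *\<^sub>R tangent_s (vd p s) (vd q s) (vd V s) 0 + snd v *\<^sub>R tangent_t (p s) (q s) 0)"
    using has_derivative_circles[OF assms(2-7)] by (rule frechet_derivative_at[symmetric])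
  then have "?D (0, 1) = ?D (0, 0)"
    using * by (simp add: tangent_t_def cmul_zero_right)
  moreover have "inj ?D" using assms(1) s by (auto simp: immersion_on_def)
  ultimately show False by (auto dest: injD)
qed

text \<open>
  The Lagrangian condition forces \<open>\<langle>p', q\<rangle> = \<langle>p, q'\<rangle>\<close>, while differentiating \<open>\<langle>p, q\<rangle> = 0\<close> forces
  \<open>\<langle>p', q\<rangle> = - \<langle>p, q'\<rangle>\<close>; so both products vanish, which is what makes the surfaces rigid.
\<close>

definition lagrangian_circles :: "real set \<Rightarrow> (real \<Rightarrow> C2) \<Rightarrow> (real \<Rightarrow> C2) \<Rightarrow> (real \<Rightarrow> C2) \<Rightarrow> bool" where
  "lagrangian_circles I p q V \<longleftrightarrow> smooth_on I p \<and> smooth_on I q \<and> smooth_on I V \<and>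
     (\<forall>s\<in>I. herm (p s) (q s) = 0 \<and> Re (herm (vd p s) (p s)) = Re (herm (vd q s) (q s)) \<and>
        herm (vd p s) (q s) = 0 \<and> herm (p s) (vd q s) = 0 \<and>
        herm (vd V s) (q s) = herm (p s) (vd V s))"

lemma lagrangian_circles_swap:
  assumes "lagrangian_circles I p q V" shows "lagrangian_circles I q p V"
  using assms unfolding lagrangian_circles_def by (metis cnj_herm complex_cnj_zero)

lemma lagrangian_circles_subset:
  "lagrangian_circles I p q V \<Longrightarrow> K \<subseteq> I \<Longrightarrow> lagrangian_circles K p q V"
  unfolding lagrangian_circles_def by (meson smooth_on_subset subsetD)

lemma has_vector_derivative_herm:
  assumes f: "(f has_vector_derivative f') (at s)" and g: "(g has_vector_derivative g') (at s)"
  shows "((\<lambda>s. herm (f s) (g s)) has_vector_derivative herm (f s) g' + herm f' (g s)) (at s)"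
proof -
  have *: "((\<lambda>s. fst (h s)) has_vector_derivative fst h') (at s)"
    "((\<lambda>s. snd (h s)) has_vector_derivative snd h') (at s)"
    if "(h has_vector_derivative h') (at s)" for h :: "real \<Rightarrow> C2" and h'
    using that by (auto intro: bounded_linear.has_vector_derivative bounded_linear_fst
        bounded_linear_snd)
  have c: "((\<lambda>s. cnj (h s)) has_vector_derivative cnj h') (at s)"
    if "(h has_vector_derivative h') (at s)" for h h'
    using that by (rule bounded_linear.has_vector_derivative[OF bounded_linear_cnj])
  have "((\<lambda>s. fst (f s) * cnj (fst (g s)) + snd (f s) * cnj (snd (g s))) has_vector_derivative
      (fst (f s) * cnj (fst g') + fst f' * cnj (fst (g s))) +
      (snd (f s) * cnj (snd g') + snd f' * cnj (snd (g s)))) (at s)"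
    by (intro has_vector_derivative_add has_vector_derivative_mult * c f g)
  then show ?thesis by (simp add: herm_def algebra_simps)
qed

text \<open>
  Up to sign the constant is the symplectic area \<open>\<langle>a, J b\<rangle>\<close> of the orthogonal radii \<open>a\<close>, \<open>b\<close> of the
  circle.  It vanishes when the planes of the circles are Lagrangian, and for complex circles it is
  the square of the radius, up to sign.
\<close>

lemma norm_difference_constant:
  assumes I: "open_interval I" and L: "lagrangian_circles I p q V" and "a \<in> I" "b \<in> I"
  shows "(norm (p a))\<^sup>2 - (norm (q a))\<^sup>2 = (norm (p b))\<^sup>2 - (norm (q b))\<^sup>2"
proof -
  have "open I" using I by (simp add: open_interval_def)
  note d = has_vector_derivative_vd[OF this]
  have "((\<lambda>s. p s \<bullet> p s - q s \<bullet> q s) has_vector_derivative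
      (p s \<bullet> vd p s + vd p s \<bullet> p s) - (q s \<bullet> vd q s + vd q s \<bullet> q s)) (at s)" if "s \<in> I" for s
    using that L unfolding lagrangian_circles_def
    by (intro has_vector_derivative_diff bounded_bilinear.has_vector_derivative
        bounded_bilinear_inner d) blast+
  moreover have "(p s \<bullet> vd p s + vd p s \<bullet> p s) - (q s \<bullet> vd q s + vd q s \<bullet> q s) = 0"
    if "s \<in> I" for s
    using that L unfolding lagrangian_circles_def
    by (simp add: inner_commute[of "p s"] inner_commute[of "q s"]) (simp add: inner_eq_Re_herm)
  ultimately have "p a \<bullet> p a - q a \<bullet> q a = p b \<bullet> p b - q b \<bullet> q b"
    using assms by (intro constant_if_derivative_zero[OF I]) auto
  then show ?thesis by (simp add: dot_square_norm)
qed

text \<open>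
  The orthogonal radii are \<open>p + q\<close> and \<open>J (p - q)\<close>, both of squared length \<open>|p|\<^sup>2 + |q|\<^sup>2\<close>.  This is
  positive because an immersion has no circle of radius zero.
\<close>

lemma cyclic_immersion_if_circles:
  assumes I: "open I" and imm: "immersion_on I X"
    and sm: "smooth_on I p" "smooth_on I q" "smooth_on I V"
    and pq: "\<And>s. s \<in> I \<Longrightarrow> herm (p s) (q s) = 0"
    and X: "\<And>s t. s \<in> I \<Longrightarrow> X s t = circle_family p q V s t"
  shows "cyclic_immersion I X"
proof -
  define a b r where "a = (\<lambda>s. p s + q s)" and "b = (\<lambda>s. J (p s - q s))"
    and "r = (\<lambda>s. sqrt (Re (herm (p s) (p s)) + Re (herm (q s) (q s))))"
  have nz: "p s \<noteq> 0 \<or> q s \<noteq> 0" if "s \<in> I" for s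
    using immersion_circles_nonzero[OF imm I sm X that] .
  have pos: "Re (herm (p s) (p s)) + Re (herm (q s) (q s)) > 0" if "s \<in> I" for s
    using nz[OF that] by (auto simp: herm_self add_pos_nonneg add_nonneg_pos
        simp del: of_real_power)
  have qp: "herm (q s) (p s) = 0" if "s \<in> I" for s
    using pq[OF that] by (metis cnj_herm complex_cnj_zero)
  have "(norm (a s))\<^sup>2 = (r s)\<^sup>2" "(norm (b s))\<^sup>2 = (r s)\<^sup>2" "a s \<bullet> b s = 0" if "s \<in> I" for s
    using pos[OF that] pq[OF that] qp[OF that]
    by (simp_all add: a_def b_def r_def power2_norm_eq_inner inner_eq_Re_herm herm_simps)
      (simp add: herm_self)
  moreover have r: "r s > 0" if "s \<in> I" for s using pos[OF that] by (simp add: r_def)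
  ultimately have ab: "norm (a s) = r s" "norm (b s) = r s" "a s \<bullet> b s = 0" if "s \<in> I" for s
    using that less_imp_le[OF r[OF that]] by (auto intro: power2_eq_imp_eq)
  have smr: "smooth_on I r"
    unfolding r_def using pos by (intro smooth_intros I sm)
  have "smooth_on I (\<lambda>s. inverse (r s) *\<^sub>R a s)" "smooth_on I (\<lambda>s. inverse (r s) *\<^sub>R b s)"
    unfolding a_def b_def by (intro smooth_intros I sm smr; use r in force)+
  moreover have "\<forall>s\<in>I. r s > 0 \<and> norm (inverse (r s) *\<^sub>R a s) = 1 \<and>
      norm (inverse (r s) *\<^sub>R b s) = 1 \<and> (inverse (r s) *\<^sub>R a s) \<bullet> (inverse (r s) *\<^sub>R b s) = 0"
  proof
    fix s assume "s \<in> I"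
    with r[of s] show "r s > 0 \<and> norm (inverse (r s) *\<^sub>R a s) = 1 \<and>
      norm (inverse (r s) *\<^sub>R b s) = 1 \<and> (inverse (r s) *\<^sub>R a s) \<bullet> (inverse (r s) *\<^sub>R b s) = 0"
      by (simp add: ab)
  qed
  moreover have "\<forall>s\<in>I. \<forall>t. X s t = r s *\<^sub>R (cos t *\<^sub>R inverse (r s) *\<^sub>R a s
      + sin t *\<^sub>R inverse (r s) *\<^sub>R b s) + V s"
  proof (intro ballI allI)
    fix s t assume s: "s \<in> I"
    have "r s *\<^sub>R x *\<^sub>R inverse (r s) *\<^sub>R v = x *\<^sub>R v" for x and v :: C2
      using r[OF s] by simp
    then show "X s t = r s *\<^sub>R (cos t *\<^sub>R inverse (r s) *\<^sub>R a s
        + sin t *\<^sub>R inverse (r s) *\<^sub>R b s) + V s"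
      by (simp add: X[OF s] circle_family_real_form a_def b_def
          scaleR_add_right[of "r s"] del: scaleR_scaleR)
  qed
  ultimately show ?thesis
    unfolding cyclic_immersion_def using imm smr sm(3) by blast
qed

lemma cyclic_immersion_circles:
  assumes I: "open I" and X: "cyclic_immersion I X"
  obtains p q V where "smooth_on I p" "smooth_on I q" "smooth_on I V"
    "\<And>s. s \<in> I \<Longrightarrow> herm (p s) (q s) = 0" "\<And>s t. s \<in> I \<Longrightarrow> X s t = circle_family p q V s t"
proof -
  from X obtain r e1 e2 V where sm: "smooth_on I r" "smooth_on I e1" "smooth_on I e2" "smooth_on I V"
    and e: "\<And>s. s \<in> I \<Longrightarrow> r s > 0 \<and> norm (e1 s) = 1 \<and> norm (e2 s) = 1 \<and> e1 s \<bullet> e2 s = 0"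
    and eq: "\<And>s t. s \<in> I \<Longrightarrow> X s t = r s *\<^sub>R (cos t *\<^sub>R e1 s + sin t *\<^sub>R e2 s) + V s"
    unfolding cyclic_immersion_def by blast
  define p q where "p = (\<lambda>s. (r s / 2) *\<^sub>R (e1 s - J (e2 s)))"
    and "q = (\<lambda>s. (r s / 2) *\<^sub>R (e1 s + J (e2 s)))"
  show thesis
  proof
    show "smooth_on I p" "smooth_on I q" "smooth_on I V"
      unfolding p_def q_def by (intro smooth_intros I sm; simp)+
    show "herm (p s) (q s) = 0" if "s \<in> I" for s
    proof -
      have "Re (herm (e1 s) (e2 s)) = 0" using e[OF that] by (simp add: inner_eq_Re_herm)
      then have "herm (e1 s) (e2 s) + herm (e2 s) (e1 s) = 0"
        using cnj_herm[of "e1 s" "e2 s"] by (auto simp: complex_eq_iff)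
      moreover have "herm (e1 s) (e1 s) = 1" "herm (e2 s) (e2 s) = 1"
        using e[OF that] by (auto simp: herm_self)
      moreover have "herm (p s) (q s) = (of_real (r s / 2))\<^sup>2 * (herm (e1 s) (e1 s)
         - herm (e2 s) (e2 s) - \<i> * (herm (e1 s) (e2 s) + herm (e2 s) (e1 s)))"
        by (simp add: p_def q_def herm_simps power2_eq_square algebra_simps)
      ultimately show ?thesis by simp
    qed
    show "X s t = circle_family p q V s t" if "s \<in> I" for s t
    proof -
      have "p s + q s = r s *\<^sub>R e1 s" "J (p s - q s) = r s *\<^sub>R e2 s"
        by (simp_all add: p_def q_def cmul_def prod_eq_iff scaleR_conv_of_real algebra_simps)
      then show ?thesis
        unfolding eq[OF that] circle_family_real_form by (simp add: algebra_simps)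
    qed
  qed
qed

text \<open>
  Cyclic Lagrangian immersions are exactly the immersed families of circles with
  \<^const>\<open>lagrangian_circles\<close>.  One direction serves to classify them, the other to recognize the
  normal forms.
\<close>

theorem cyclic_lagrangian_circles:
  assumes I: "open I" and X: "cyclic_immersion I X" "lagrangian_on I X"
  obtains p q V where "lagrangian_circles I p q V"
    "\<And>s t. s \<in> I \<Longrightarrow> X s t = circle_family p q V s t" "\<And>s. s \<in> I \<Longrightarrow> p s \<noteq> 0 \<or> q s \<noteq> 0"
proof -
  from cyclic_immersion_circles[OF I X(1)] obtain p q V
    where sm: "smooth_on I p" "smooth_on I q" "smooth_on I V"
      and pq: "\<And>s. s \<in> I \<Longrightarrow> herm (p s) (q s) = 0"
      and eq: "\<And>s t. s \<in> I \<Longrightarrow> X s t = circle_family p q V s t" by blast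
  have imm: "immersion_on I X" using X by (simp add: cyclic_immersion_def)
  have lag: "Re (herm (vd p s) (p s)) = Re (herm (vd q s) (q s)) \<and>
    herm (vd p s) (q s) = herm (p s) (vd q s) \<and> herm (vd V s) (q s) = herm (p s) (vd V s)"
    if "s \<in> I" for s
    using X(2) that lagrangian_on_circles_iff[OF I sm eq] by blast
  have sum0: "herm (p s) (vd q s) + herm (vd p s) (q s) = 0" if "s \<in> I" for s
  proof (rule vector_derivative_unique_at)
    show "((\<lambda>s. herm (p s) (q s)) has_vector_derivative
        herm (p s) (vd q s) + herm (vd p s) (q s)) (at s)"
      using that by (intro has_vector_derivative_herm has_vector_derivative_vd[OF I] sm)
    have "((\<lambda>_. 0 :: complex) has_vector_derivative 0) (at s)" by simp
    then show "((\<lambda>s. herm (p s) (q s)) has_vector_derivative 0) (at s)"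
      by (rule has_vector_derivative_transform_within_open[OF _ I that]) (simp add: pq)
  qed
  have "herm (p s) (vd q s) = 0" "herm (vd p s) (q s) = 0" if "s \<in> I" for s
  proof -
    from sum0[OF that] lag[OF that] have "2 * herm (p s) (vd q s) = 0" by simp
    then show "herm (p s) (vd q s) = 0" "herm (vd p s) (q s) = 0" using lag[OF that] by simp_all
  qed
  then have "lagrangian_circles I p q V"
    unfolding lagrangian_circles_def using sm pq lag by auto
  with that eq immersion_circles_nonzero[OF imm I sm eq] show thesis by blast
qed

theorem cyclic_lagrangian_if_circles:
  assumes I: "open I" and imm: "immersion_on I X" and L: "lagrangian_circles I p q V"
    and X: "\<And>s t. s \<in> I \<Longrightarrow> X s t = circle_family p q V s t"
  shows "cyclic_immersion I X \<and> lagrangian_on I X"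
proof
  have sm: "smooth_on I p" "smooth_on I q" "smooth_on I V"
    using L by (auto simp: lagrangian_circles_def)
  show "cyclic_immersion I X"
    using L by (intro cyclic_immersion_if_circles[OF I imm sm _ X]) (auto simp: lagrangian_circles_def)
  show "lagrangian_on I X"
    using L by (intro iffD2[OF lagrangian_on_circles_iff[OF I sm X]])
      (auto simp: lagrangian_circles_def)
qed

text \<open>Being an immersion is a property of the surface and not of its parametrization.\<close>

lemma immersion_on_congruent:
  assumes I: "open I" and imm: "immersion_on I X" and XY: "congruent_on I X Y"
  shows "immersion_on I Y"
proof -
  from XY obtain U b \<theta> \<sigma> where U: "unitary U" and \<theta>: "smooth_on I \<theta>" and \<sigma>: "\<sigma> = 1 \<or> \<sigma> = -1"
    and eq: "\<And>s t. s \<in> I \<Longrightarrow> U (X s t) + b = Y s (\<sigma> * t + \<theta> s)"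
    unfolding congruent_on_def by blast
  show ?thesis
    unfolding immersion_on_def
  proof (intro ballI allI)
    fix s t :: real assume s: "s \<in> I"
    \<comment> \<open>The inverse of the change of parameters \<open>(s, t) \<mapsto> (s, \<sigma> t + \<theta> s)\<close>, as \<open>\<sigma>\<close> is its own inverse.\<close>
    let ?\<psi> = "\<lambda>x :: real \<times> real. (fst x, \<sigma> * (snd x - \<theta> (fst x)))"
    let ?X = "\<lambda>(s, t). X s t" and ?Y = "\<lambda>(s, t). Y s t"
    have eq': "U (?X (?\<psi> x)) + b = ?Y x" if "x \<in> I \<times> UNIV" for x
      using that eq[of "fst x" "\<sigma> * (snd x - \<theta> (fst x))"] \<sigma> by (auto simp: case_prod_unfold)
    have "((\<lambda>x. \<theta> (fst x)) has_derivative (\<lambda>v. fst v *\<^sub>R vd \<theta> s)) (at (s, t))"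
      using has_derivative_compose[OF bounded_linear_imp_has_derivative[OF bounded_linear_fst],
          of \<theta> "\<lambda>h. h *\<^sub>R vd \<theta> s" "(s, t)"] has_vector_derivative_vd[OF I \<theta> s]
      by (simp add: has_vector_derivative_def)
    then have \<psi>: "(?\<psi> has_derivative (\<lambda>v. (fst v, \<sigma> * (snd v - fst v *\<^sub>R vd \<theta> s)))) (at (s, t))"
      by (auto intro!: derivative_eq_intros)
    let ?D = "frechet_derivative ?X (at (?\<psi> (s, t)))"
    have "?X differentiable at (?\<psi> (s, t))" and inj: "inj ?D"
      using imm s by (auto simp: immersion_on_def)
    then have "(?X has_derivative ?D) (at (?\<psi> (s, t)))"
      by (simp add: frechet_derivative_works)
    from has_derivative_compose[OF \<psi> this]
    have "((\<lambda>x. U (?X (?\<psi> x)) + b) has_derivative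
        (\<lambda>v. U (?D (fst v, \<sigma> * (snd v - fst v *\<^sub>R vd \<theta> s))))) (at (s, t))"
      by (auto intro!: derivative_eq_intros
          bounded_linear.has_derivative[OF unitary_bounded_linear[OF U]])
    then have Y: "(?Y has_derivative (\<lambda>v. U (?D (fst v, \<sigma> * (snd v - fst v *\<^sub>R vd \<theta> s))))) (at (s, t))"
      by (rule has_derivative_transform_within_open[where s = "I \<times> UNIV"])
        (use I s eq' in \<open>auto simp: open_Times\<close>)
    have "inj U"
      using unitary_eq_0_iff[OF U] linear_injective_0[of U] unitary_bounded_linear[OF U]
      by (simp add: bounded_linear.linear)
    moreover have "inj (\<lambda>v. (fst v, \<sigma> * (snd v - fst v *\<^sub>R vd \<theta> s)))"
      using \<sigma> by (auto simp: inj_def)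
    ultimately have "inj (\<lambda>v. U (?D (fst v, \<sigma> * (snd v - fst v *\<^sub>R vd \<theta> s))))"
      using inj inj_compose[of U "\<lambda>v. ?D (fst v, \<sigma> * (snd v - fst v *\<^sub>R vd \<theta> s))"]
        inj_compose[of ?D "\<lambda>v. (fst v, \<sigma> * (snd v - fst v *\<^sub>R vd \<theta> s))"]
      by (simp add: o_def)
    then show "?Y differentiable at (s, t) \<and> inj (frechet_derivative ?Y (at (s, t)))"
      using Y frechet_derivative_at[OF Y] by (auto simp: differentiable_def)
  qed
qed

section \<open>The normal forms are cyclic and Lagrangian\<close>

lemma lagrangian_circlesI:
  assumes "smooth_on I p" "smooth_on I q" "smooth_on I V"
    and "\<And>s. s \<in> I \<Longrightarrow> (p has_vector_derivative p' s) (at s)"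
    and "\<And>s. s \<in> I \<Longrightarrow> (q has_vector_derivative q' s) (at s)"
    and "\<And>s. s \<in> I \<Longrightarrow> (V has_vector_derivative V' s) (at s)"
    and "\<And>s. s \<in> I \<Longrightarrow> herm (p s) (q s) = 0"
    and "\<And>s. s \<in> I \<Longrightarrow> Re (herm (p' s) (p s)) = Re (herm (q' s) (q s))"
    and "\<And>s. s \<in> I \<Longrightarrow> herm (p' s) (q s) = 0"
    and "\<And>s. s \<in> I \<Longrightarrow> herm (p s) (q' s) = 0"
    and "\<And>s. s \<in> I \<Longrightarrow> herm (V' s) (q s) = herm (p s) (V' s)"
  shows "lagrangian_circles I p q V"
proof -
  have "vd p s = p' s" "vd q s = q' s" "vd V s = V' s" if "s \<in> I" for s
    using that assms(4-6) by (simp_all add: vector_derivative_at)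
  then show ?thesis unfolding lagrangian_circles_def using assms by auto
qed

lemma derivative_zero_if_constant:
  assumes "open I" "s \<in> I" "\<And>u. u \<in> I \<Longrightarrow> f u = c" "(f has_vector_derivative d) (at s)"
  shows "d = 0"
proof (rule vector_derivative_unique_at[OF assms(4)])
  have "((\<lambda>_. c) has_vector_derivative 0) (at s)" by simp
  then show "(f has_vector_derivative 0) (at s)"
    by (rule has_vector_derivative_transform_within_open[OF _ assms(1,2)]) (simp add: assms(3))
qed

lemma map_I_eq_circle_family:
  "map_I s0 r \<phi> W1 W2 s t = circle_family
     (\<lambda>s. cmul (of_real (r s / 2) * cis (\<phi> s)) (1, - \<i>))
     (\<lambda>s. cmul (of_real (r s / 2) * cis (\<phi> s)) (1, \<i>))
     (\<lambda>s. LBINT u=s0..s. cmul (cis (\<phi> u)) (of_real (W1 u), of_real (W2 u))) s t"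
proof -
  have "cmul (of_real (r s) * z) (of_real (cos t), of_real (sin t)) =
      cmul (cis t) (cmul (of_real (r s / 2) * z) (1, - \<i>)) +
      cmul (cis (- t)) (cmul (of_real (r s / 2) * z) (1, \<i>))" for z
    by (simp add: cmul_def complex_eq_iff field_simps)
  then show ?thesis by (simp add: map_I_def circle_family_def)
qed

text \<open>
  Here \<open>p\<close> and \<open>q\<close> are one common complex multiple \<open>z\<close> of the fixed orthogonal vectors \<open>(1, -\<i>)\<close> and
  \<open>(1, \<i>)\<close> of equal length, which settles all conditions but the one on the centres.  That one holds
  because the velocity of the centres is a real vector turned by the phase of \<open>z\<close>.
\<close>

lemma map_I_lagrangian_circles:
  assumes "data_I I s0 r \<phi> W1 W2"
  shows "lagrangian_circles I
     (\<lambda>s. cmul (of_real (r s / 2) * cis (\<phi> s)) (1, - \<i>))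
     (\<lambda>s. cmul (of_real (r s / 2) * cis (\<phi> s)) (1, \<i>))
     (\<lambda>s. LBINT u=s0..s. cmul (cis (\<phi> u)) (of_real (W1 u), of_real (W2 u)))"
proof -
  have oi: "open_interval I" "s0 \<in> I" and I: "open I"
    and sm: "smooth_on I r" "smooth_on I \<phi>" "smooth_on I W1" "smooth_on I W2"
    using assms by (auto simp: data_I_def open_interval_def)
  define z where "z = (\<lambda>s. of_real (r s / 2) * cis (\<phi> s))"
  have smz: "smooth_on I z" unfolding z_def by (intro smooth_intros I sm) simp
  have dz: "((\<lambda>s. cmul (z s) v) has_vector_derivative cmul (vd z s) v) (at s)" if "s \<in> I" for s v
    using bounded_bilinear.has_vector_derivative[OF bounded_bilinear_cmul
        has_vector_derivative_vd[OF I smz that] has_vector_derivative_const[of v]]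
    by (simp add: cmul_zero_right)
  have smw: "smooth_on I (\<lambda>u. cmul (cis (\<phi> u)) (of_real (W1 u), of_real (W2 u)))"
    by (intro smooth_intros I sm)
  have e: "herm (1, - \<i>) (1, \<i>) = 0" "herm (1, \<i>) (1, - \<i>) = 0"
    "herm (1, \<i>) (1, \<i>) = 2" "herm (1, - \<i>) (1, - \<i>) = 2"
    by (simp_all add: herm_def)
  have zz: "cis x * cnj (cis x) = 1" for x by (simp add: cis_cnj cis_mult)
  have V: "herm (cmul (cis (\<phi> s)) (of_real (W1 s), of_real (W2 s))) (cmul (z s) (1, \<i>)) =
      herm (cmul (z s) (1, - \<i>)) (cmul (cis (\<phi> s)) (of_real (W1 s), of_real (W2 s)))" for s
  proof -
    have "herm (cmul (cis (\<phi> s)) (of_real (W1 s), of_real (W2 s))) (cmul (z s) (1, \<i>)) =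
       (cis (\<phi> s) * cnj (cis (\<phi> s))) * of_real (r s / 2) * (of_real (W1 s) - \<i> * of_real (W2 s))"
      by (simp add: herm_simps z_def) (simp add: herm_def algebra_simps)
    moreover have "herm (cmul (z s) (1, - \<i>)) (cmul (cis (\<phi> s)) (of_real (W1 s), of_real (W2 s))) =
       (cis (\<phi> s) * cnj (cis (\<phi> s))) * of_real (r s / 2) * (of_real (W1 s) - \<i> * of_real (W2 s))"
      by (simp add: herm_simps z_def) (simp add: herm_def algebra_simps)
    ultimately show ?thesis by (simp only:)
  qed
  have fold_z: "of_real (r s / 2) * cis (\<phi> s) = z s" for s by (simp add: z_def)
  show ?thesis
    unfolding fold_z
  proof (rule lagrangian_circlesI[OF _ _ _ dz[of _ "(1, - \<i>)"] dz[of _ "(1, \<i>)"]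
        has_vector_derivative_LBINT[OF oi _ smooth_on_imp_continuous_on[OF I smw]]])
    show "smooth_on I (\<lambda>s. cmul (z s) (1, - \<i>))" "smooth_on I (\<lambda>s. cmul (z s) (1, \<i>))"
      by (intro smooth_intros I smz)+
  qed (use smooth_on_LBINT[OF oi smw] V in \<open>simp_all add: herm_simps e\<close>)
qed

lemma map_II_eq_circle_family:
  "map_II s0 c \<gamma> W s t = circle_family (\<lambda>s. c *\<^sub>R \<gamma> s) (\<lambda>_. 0)
     (\<lambda>s. LBINT u=s0..s. cmul (W u) (perp (\<gamma> u))) s t"
  by (simp add: map_II_def circle_family_def perp_def cmul_def prod_eq_iff mult.commute)

text \<open>
  The circles are complex and of constant radius, so only the velocity of the centres is
  constrained: it must be Hermitian orthogonal to \<open>\<gamma>\<close>.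
\<close>

lemma map_II_lagrangian_circles:
  assumes "data_II I s0 c \<gamma> W"
  shows "lagrangian_circles I (\<lambda>s. c *\<^sub>R \<gamma> s) (\<lambda>_. 0)
     (\<lambda>s. LBINT u=s0..s. cmul (W u) (perp (\<gamma> u)))"
proof -
  have oi: "open_interval I" "s0 \<in> I" and I: "open I"
    and sm: "smooth_on I \<gamma>" "smooth_on I W" and n: "\<And>s. s \<in> I \<Longrightarrow> norm (\<gamma> s) = 1"
    using assms by (auto simp: data_II_def open_interval_def legendrian_sphere_def)
  have smw: "smooth_on I (\<lambda>u. cmul (W u) (perp (\<gamma> u)))"
    unfolding perp_def by (intro smooth_intros I sm)
  have "vd \<gamma> s \<bullet> \<gamma> s = 0" if "s \<in> I" for s
  proof -
    have "\<gamma> s \<bullet> vd \<gamma> s + vd \<gamma> s \<bullet> \<gamma> s = 0"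
      using n has_vector_derivative_vd[OF I sm(1) that]
      by (intro derivative_zero_if_constant[OF I that, of "\<lambda>s. \<gamma> s \<bullet> \<gamma> s" 1]
          bounded_bilinear.has_vector_derivative[OF bounded_bilinear_inner])
        (auto simp: dot_square_norm)
    then show ?thesis by (simp add: inner_commute)
  qed
  then have Re0: "Re (herm (vd \<gamma> s) (\<gamma> s)) = 0" if "s \<in> I" for s
    using that by (simp add: inner_eq_Re_herm)
  have dp: "((\<lambda>s. c *\<^sub>R \<gamma> s) has_vector_derivative c *\<^sub>R vd \<gamma> s) (at s)" if "s \<in> I" for s
    using has_vector_derivative_vd[OF I sm(1) that]
    by (rule bounded_linear.has_vector_derivative[OF bounded_linear_scaleR_right])
  show ?thesis
  proof (rule lagrangian_circlesI[OF _ _ _ dp has_vector_derivative_const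
        has_vector_derivative_LBINT[OF oi _ smooth_on_imp_continuous_on[OF I smw]]])
    show "smooth_on I (\<lambda>s. c *\<^sub>R \<gamma> s)" "smooth_on I (\<lambda>_. 0 :: C2)"
      by (intro smooth_intros I sm)+
  qed (use smooth_on_LBINT[OF oi smw] Re0 in \<open>simp_all add: herm_simps\<close>)
qed

lemma map_III_eq_circle_family:
  "map_III s0 c \<alpha> W s t = circle_family (\<lambda>s. c *\<^sub>R (fst (\<alpha> s), 0)) (\<lambda>s. c *\<^sub>R (0, snd (\<alpha> s)))
     (\<lambda>s. LBINT u=s0..s. (W u * of_real ((cmod (snd (\<alpha> u)))\<^sup>2), cnj (W u) * fst (\<alpha> u) * snd (\<alpha> u)))
     s t"
  by (simp add: map_III_def circle_family_def cmul_def prod_eq_iff mult.commute)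

text \<open>
  Since \<open>p\<close> and \<open>q\<close> stay on the two coordinate axes, the equation for the velocity \<open>(v\<^sub>1, v\<^sub>2)\<close> of the
  centres is \<open>v\<^sub>2 cnj \<alpha>\<^sub>2 = \<alpha>\<^sub>1 cnj v\<^sub>1\<close>.  Its solutions are the integrands of the third normal form,
  as \<open>\<alpha>\<^sub>2\<close> has no zeros.
\<close>

lemma map_III_lagrangian_circles:
  assumes "data_III I s0 c \<alpha> W"
  shows "lagrangian_circles I (\<lambda>s. c *\<^sub>R (fst (\<alpha> s), 0)) (\<lambda>s. c *\<^sub>R (0, snd (\<alpha> s)))
     (\<lambda>s. LBINT u=s0..s. (W u * of_real ((cmod (snd (\<alpha> u)))\<^sup>2), cnj (W u) * fst (\<alpha> u) * snd (\<alpha> u)))"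
proof -
  have oi: "open_interval I" "s0 \<in> I" and I: "open I"
    and sm: "smooth_on I \<alpha>" "smooth_on I W"
    and n: "\<And>s. s \<in> I \<Longrightarrow> (cmod (fst (\<alpha> s)))\<^sup>2 - (cmod (snd (\<alpha> s)))\<^sup>2 = -1"
    using assms by (auto simp: data_III_def open_interval_def legendrian_adS_def)
  have smw: "smooth_on I (\<lambda>u. (W u * of_real ((cmod (snd (\<alpha> u)))\<^sup>2),
      cnj (W u) * fst (\<alpha> u) * snd (\<alpha> u)))"
    unfolding complex_norm_square by (intro smooth_intros I sm)
  have norm_square: "(of_real (cmod z))\<^sup>2 = z * cnj z" for z
    by (metis complex_norm_square of_real_power)
  define p q :: "real \<Rightarrow> C2" where "p = (\<lambda>s. (fst (\<alpha> s), 0))" and "q = (\<lambda>s. (0, snd (\<alpha> s)))"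
  define p' q' :: "real \<Rightarrow> C2" where "p' = (\<lambda>s. (fst (vd \<alpha> s), 0))" and "q' = (\<lambda>s. (0, snd (vd \<alpha> s)))"
  note defs = p_def q_def p'_def q'_def
  have L: "bounded_linear (\<lambda>v. (fst v, 0 :: complex) :: C2)"
    "bounded_linear (\<lambda>v. (0 :: complex, snd v) :: C2)"
    by (auto intro!: bounded_linear_Pair bounded_linear_fst bounded_linear_snd bounded_linear_zero)
  have pq: "(p has_vector_derivative p' s) (at s)" "(q has_vector_derivative q' s) (at s)"
    if "s \<in> I" for s
    unfolding defs using has_vector_derivative_vd[OF I sm(1) that]
    by (rule bounded_linear.has_vector_derivative[OF L(1)]
        bounded_linear.has_vector_derivative[OF L(2)])+
  have Re_eq: "Re (herm (p' s) (p s)) = Re (herm (q' s) (q s))" if "s \<in> I" for s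
  proof -
    have "(p s \<bullet> p' s + p' s \<bullet> p s) - (q s \<bullet> q' s + q' s \<bullet> q s) = 0"
      using n pq[OF that]
      by (intro derivative_zero_if_constant[OF I that, of "\<lambda>s. p s \<bullet> p s - q s \<bullet> q s" "-1"]
          has_vector_derivative_diff bounded_bilinear.has_vector_derivative[OF bounded_bilinear_inner])
        (auto simp: p_def q_def dot_square_norm)
    then show ?thesis by (simp add: inner_commute inner_eq_Re_herm[symmetric])
  qed
  have d: "((\<lambda>s. c *\<^sub>R (fst (\<alpha> s), 0)) has_vector_derivative c *\<^sub>R p' s) (at s)"
    "((\<lambda>s. c *\<^sub>R (0, snd (\<alpha> s))) has_vector_derivative c *\<^sub>R q' s) (at s)" if "s \<in> I" for s
    using bounded_linear.has_vector_derivative[OF bounded_linear_scaleR_right pq(1)[OF that]]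
      bounded_linear.has_vector_derivative[OF bounded_linear_scaleR_right pq(2)[OF that]]
    unfolding p_def q_def by blast+
  show ?thesis
  proof (rule lagrangian_circlesI[OF _ _ _ d
        has_vector_derivative_LBINT[OF oi _ smooth_on_imp_continuous_on[OF I smw]]])
    show "smooth_on I (\<lambda>s. c *\<^sub>R (fst (\<alpha> s), 0 :: complex))"
      "smooth_on I (\<lambda>s. c *\<^sub>R (0 :: complex, snd (\<alpha> s)))"
      by (intro smooth_intros I sm)+
    show "Re (herm (c *\<^sub>R p' s) (c *\<^sub>R (fst (\<alpha> s), 0))) = Re (herm (c *\<^sub>R q' s) (c *\<^sub>R (0, snd (\<alpha> s))))"
      if "s \<in> I" for s
      using Re_eq[OF that] unfolding p_def q_def herm_simps by simp
  qed (use smooth_on_LBINT[OF oi smw] in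
      \<open>simp_all add: herm_simps\<close>, simp_all add: defs herm_def norm_square)
qed

text \<open>With constant phase the centres also move inside the real span of the two directions.\<close>

lemma map_I_constant_phase:
  assumes data: "data_I I s0 r \<phi> W1 W2" and \<phi>: "\<And>s. s \<in> I \<Longrightarrow> \<phi> s = \<phi>0" and s: "s \<in> I"
  shows "map_I s0 r \<phi> W1 W2 s t \<in> span {cmul (cis \<phi>0) (1, 0), cmul (cis \<phi>0) (0, 1)}"
proof -
  let ?u = "cmul (cis \<phi>0) (1, 0)" and ?v = "cmul (cis \<phi>0) (0, 1)"
  have oi: "open_interval I" "s0 \<in> I" and I: "open I"
    and sm: "smooth_on I \<phi>" "smooth_on I W1" "smooth_on I W2"
    using data by (auto simp: data_I_def open_interval_def)
  have *: "cmul (of_real a * cis \<phi>0) (of_real x, of_real y) = (a * x) *\<^sub>R ?u + (a * y) *\<^sub>R ?v"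
    for a x y :: real
    by (simp add: cmul_def scaleR_conv_of_real algebra_simps)
  define F where "F = (\<lambda>s::real. (LBINT u=s0..s. W1 u) *\<^sub>R ?u + (LBINT u=s0..s. W2 u) *\<^sub>R ?v)"
  have "(F has_vector_derivative cmul (cis (\<phi> u)) (of_real (W1 u), of_real (W2 u))) (at u)"
    if "u \<in> I" for u
  proof -
    have "(F has_vector_derivative (W1 u *\<^sub>R ?u + W2 u *\<^sub>R ?v)) (at u)"
      unfolding F_def
      using has_vector_derivative_LBINT[OF oi that smooth_on_imp_continuous_on[OF I sm(2)]]
        has_vector_derivative_LBINT[OF oi that smooth_on_imp_continuous_on[OF I sm(3)]]
      by (intro has_vector_derivative_add bounded_linear.has_vector_derivative[OF
          bounded_linear_scaleR_left])
    then show ?thesis using *[of 1 "W1 u" "W2 u"] by (simp add: \<phi>[OF that])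
  qed
  moreover have "continuous_on I (\<lambda>u. cmul (cis (\<phi> u)) (of_real (W1 u), of_real (W2 u)))"
    by (intro smooth_on_imp_continuous_on[OF I] smooth_intros I sm)
  ultimately have
    "(LBINT u=s0..s. cmul (cis (\<phi> u)) (of_real (W1 u), of_real (W2 u))) = F s - F s0"
    by (intro LBINT_eq_diff[OF oi s])
  then have "map_I s0 r \<phi> W1 W2 s t =
      ((r s * cos t) *\<^sub>R ?u + (r s * sin t) *\<^sub>R ?v) + (F s - F s0)"
    by (simp add: map_I_def \<phi>[OF s] *)
  also have "\<dots> \<in> span {?u, ?v}"
    unfolding F_def by (intro span_add span_diff span_scale span_base) auto
  finally show ?thesis .
qed

lemma lagrangian_plane_phase:
  "lagrangian_plane (span {cmul (cis \<phi>) (1, 0), cmul (cis \<phi>) (0, 1)})"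
proof -
  let ?u = "cmul (cis \<phi>) (1, 0)" and ?v = "cmul (cis \<phi>) (0, 1)"
  have zz: "cis \<phi> * cnj (cis \<phi>) = 1" by (simp add: cis_cnj cis_mult)
  have h: "herm ?u ?u = 1" "herm ?v ?v = 1" "herm ?u ?v = 0" "herm ?v ?u = 0"
    unfolding herm_cmul_left herm_cmul_right using zz by (simp_all add: herm_def mult.commute)
  have "?u \<bullet> ?v = 0" "?u \<noteq> 0" "?v \<noteq> 0"
    using h by (auto simp: inner_eq_Re_herm herm_self_eq_0_iff[symmetric])
  then have "independent {?u, ?v}" "?u \<noteq> ?v"
    using pairwise_orthogonal_independent[of "{?u, ?v}"]
    by (auto simp: pairwise_def orthogonal_def inner_commute simp del: inner_Pair)
  then have "dim (span {?u, ?v}) = 2"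
    by (simp add: dim_eq_card_independent)
  moreover have "x \<bullet> J y = 0" if "x \<in> span {?u, ?v}" "y \<in> span {?u, ?v}" for x y
  proof -
    from that obtain a b c d where "x = a *\<^sub>R ?u + b *\<^sub>R ?v" "y = c *\<^sub>R ?u + d *\<^sub>R ?v"
      by (auto simp: span_insert span_singleton algebra_simps)
    then show ?thesis
      by (simp add: inner_eq_Re_herm herm_add_left herm_add_right herm_scaleR_left
          herm_scaleR_right h herm_cmul_right[of _ \<i>])
  qed
  ultimately show ?thesis by (simp add: lagrangian_plane_def)
qed

text \<open>
  For constant \<open>\<gamma>\<close> the unitary basis \<open>\<gamma>\<close>, \<open>perp \<gamma>\<close> splits the surface into the circle factor and the
  planar curve of the centres.
\<close>

lemma map_II_constant_curve:
  assumes data: "data_II I s0 c \<gamma> W" and \<gamma>: "\<And>s. s \<in> I \<Longrightarrow> \<gamma> s = \<gamma>0"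
  shows "\<exists>U W' V2. unitary U \<and> U \<gamma>0 = (1, 0) \<and> data_II I s0 c (\<lambda>_. (1, 0)) W' \<and>
          smooth_on I V2 \<and> c \<noteq> 0 \<and>
          (\<forall>s\<in>I. \<forall>t. U (map_II s0 c \<gamma> W s t) = map_II s0 c (\<lambda>_. (1, 0)) W' s t \<and>
                      map_II s0 c (\<lambda>_. (1, 0)) W' s t = (of_real c * cis t, V2 s)) \<and>
          U ` {map_II s0 c \<gamma> W s t |s t. s \<in> I} = sphere 0 \<bar>c\<bar> \<times> V2 ` I"
proof -
  have oi: "open_interval I" "s0 \<in> I" and I: "open I"
    and sm: "smooth_on I \<gamma>" "smooth_on I W" and imm: "immersion_on I (map_II s0 c \<gamma> W)"
    and n: "norm \<gamma>0 = 1"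
    using data \<gamma> by (auto simp: data_II_def open_interval_def legendrian_sphere_def)
  define U where "U = (\<lambda>v. (herm v \<gamma>0, herm v (perp \<gamma>0)))"
  define V2 where "V2 = (\<lambda>s::real. LBINT u=s0..s. W u)"
  \<comment> \<open>The sign is that of \<open>perp (1, 0) = (0, -1)\<close>.\<close>
  define W' where "W' = (\<lambda>s. - W s)"
  have U: "unitary U" unfolding U_def by (rule unitary_rows(1)[OF n])
  have U\<gamma>: "U \<gamma>0 = (1, 0)" "U (perp \<gamma>0) = (0, 1)" by (simp_all add: U_def herm_self n)
  have smV: "smooth_on I V2" unfolding V2_def by (rule smooth_on_LBINT[OF oi sm(2)])
  have dV: "(V2 has_vector_derivative W s) (at s)" if "s \<in> I" for s
    unfolding V2_def by (rule has_vector_derivative_LBINT[OF oi that smooth_on_imp_continuous_on[OF I sm(2)]])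
  have V20: "V2 s0 = 0" by (simp add: V2_def)
  have centres: "(LBINT u=s0..s. cmul (W u) (perp (\<gamma> u))) = cmul (V2 s) (perp \<gamma>0)" if "s \<in> I" for s
  proof -
    have "(LBINT u=s0..s. cmul (W u) (perp (\<gamma> u))) =
        cmul (V2 s) (perp \<gamma>0) - cmul (V2 s0) (perp \<gamma>0)"
    proof (rule LBINT_eq_diff[OF oi that])
      show "continuous_on I (\<lambda>u. cmul (W u) (perp (\<gamma> u)))"
        unfolding perp_def by (intro smooth_on_imp_continuous_on[OF I] smooth_intros I sm)
      show "((\<lambda>s. cmul (V2 s) (perp \<gamma>0)) has_vector_derivative cmul (W u) (perp (\<gamma> u))) (at u)"
        if "u \<in> I" for u
        using bounded_bilinear.has_vector_derivative[OF bounded_bilinear_cmul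
            dV[OF that] has_vector_derivative_const[of "perp \<gamma>0"]] \<gamma>[OF that]
        by (simp add: cmul_zero_right)
    qed
    then show ?thesis by (simp add: V20 cmul_def zero_prod_def)
  qed
  have centres': "(LBINT u=s0..s. cmul (W' u) (perp (1, 0))) = (0, V2 s)" if "s \<in> I" for s
  proof -
    have "(LBINT u=s0..s. cmul (W' u) (perp (1, 0))) = (0, V2 s) - (0, V2 s0)"
    proof (rule LBINT_eq_diff[OF oi that])
      show "continuous_on I (\<lambda>u. cmul (W' u) (perp (1, 0)))"
        unfolding W'_def by (intro smooth_on_imp_continuous_on[OF I] smooth_intros I sm)
      show "((\<lambda>s. (0, V2 s)) has_vector_derivative cmul (W' u) (perp (1, 0))) (at u)"
        if "u \<in> I" for u
        using has_vector_derivative_Pair[OF has_vector_derivative_const[of 0] dV[OF that]]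
        by (simp add: W'_def cmul_def perp_def)
    qed
    then show ?thesis by (simp add: V20)
  qed
  have m1: "U (map_II s0 c \<gamma> W s t) = (of_real c * cis t, V2 s)" if "s \<in> I" for s t
  proof -
    have "map_II s0 c \<gamma> W s t = cmul (of_real c * cis t) \<gamma>0 + cmul (V2 s) (perp \<gamma>0)"
      unfolding map_II_eq_circle_family circle_family_def
      by (simp add: centres[OF that] \<gamma>[OF that]) (simp add: cmul_def scaleR_conv_of_real prod_eq_iff)
    then show ?thesis
      by (simp add: unitary_add[OF U] unitary_cmul[OF U] U\<gamma>) (simp add: cmul_def)
  qed
  have m2: "map_II s0 c (\<lambda>_. (1, 0)) W' s t = (of_real c * cis t, V2 s)" if "s \<in> I" for s t
    unfolding map_II_eq_circle_family circle_family_def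
    by (simp add: centres'[OF that]) (simp add: cmul_def scaleR_conv_of_real)
  have "congruent_on I (map_II s0 c \<gamma> W) (map_II s0 c (\<lambda>_. (1, 0)) W')"
    unfolding congruent_on_def
    by (rule exI[of _ U], rule exI[of _ 0], rule exI[of _ "\<lambda>_. 0"], rule exI[of _ 1])
      (auto simp: U m1 m2 smooth_on_const[OF I])
  then have imm': "immersion_on I (map_II s0 c (\<lambda>_. (1, 0)) W')"
    by (rule immersion_on_congruent[OF I imm])
  have "legendrian_sphere I (\<lambda>_. (1, 0))"
    by (auto simp: legendrian_sphere_def smooth_on_const[OF I] norm_prod_def)
  then have data': "data_II I s0 c (\<lambda>_. (1, 0)) W'"
    using oi imm' by (auto simp: data_II_def W'_def intro: smooth_on_minus[OF I] sm)
  have "c *\<^sub>R \<gamma> s0 \<noteq> 0 \<or> (0 :: C2) \<noteq> 0"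
    using immersion_circles_nonzero[OF imm I _ _ _ map_II_eq_circle_family oi(2)]
      map_II_lagrangian_circles[OF data] unfolding lagrangian_circles_def by blast
  then have c: "c \<noteq> 0" by auto
  have img: "U ` {map_II s0 c \<gamma> W s t |s t. s \<in> I} = sphere 0 \<bar>c\<bar> \<times> V2 ` I"
  proof (intro equalityI subsetI)
    fix x assume "x \<in> U ` {map_II s0 c \<gamma> W s t |s t. s \<in> I}"
    then show "x \<in> sphere 0 \<bar>c\<bar> \<times> V2 ` I" by (auto simp: m1 norm_mult)
  next
    fix x :: C2 assume "x \<in> sphere 0 \<bar>c\<bar> \<times> V2 ` I"
    then obtain z s where x: "x = (z, V2 s)" and z: "norm z = \<bar>c\<bar>" and s: "s \<in> I" by auto
    have "norm (z / of_real c) = 1" using z c by (simp add: norm_divide)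
    then obtain t where "z / of_real c = cis t"
      by (metis complex_unit_circle cis_Arg sgn_eq norm_one div_by_1 of_real_1 zero_neq_one norm_zero)
    then have "x = U (map_II s0 c \<gamma> W s t)" using c by (simp add: x m1[OF s] field_simps)
    with s show "x \<in> U ` {map_II s0 c \<gamma> W s t |s t. s \<in> I}" by blast
  qed
  show ?thesis
    using U U\<gamma>(1) data' smV c m1 m2 img by (intro exI[of _ U] exI[of _ W'] exI[of _ V2]) simp
qed

section \<open>The fixed pair of complex lines\<close>

text \<open>If \<open>M\<close> is an antiderivative of \<open>\<mu>\<close>, then \<open>cmul (exp (- M)) f\<close> is constant.\<close>

lemma exponential_factor:
  assumes K: "open_interval K" "s0 \<in> K" and \<mu>: "smooth_on K \<mu>"
    and f: "\<And>s. s \<in> K \<Longrightarrow> (f has_vector_derivative cmul (\<mu> s) (f s)) (at s)"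
  obtains B where "smooth_on K B" "\<And>s. s \<in> K \<Longrightarrow> f s = cmul (exp (B s)) (f s0)"
proof -
  have op: "open K" using K by (simp add: open_interval_def)
  from smooth_antiderivative[OF K(1) \<mu>] obtain M where M: "smooth_on K M"
    "\<And>s. s \<in> K \<Longrightarrow> (M has_vector_derivative \<mu> s) (at s)" by blast
  have "((\<lambda>s. cmul (exp (- M s)) (f s)) has_vector_derivative 0) (at s)" if s: "s \<in> K" for s
  proof -
    have "((\<lambda>s. exp (- M s)) has_vector_derivative - \<mu> s * exp (- M s)) (at s)"
      using field_vector_diff_chain_at[OF has_vector_derivative_minus[OF M(2)[OF s]] DERIV_exp]
      by (simp add: o_def)
    from bounded_bilinear.has_vector_derivative[OF bounded_bilinear_cmul this f[OF s]]
    show ?thesis by (simp add: cmul_def algebra_simps zero_prod_def)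
  qed
  from constant_if_derivative_zero[OF K(1) this]
  have const: "cmul (exp (- M s)) (f s) = cmul (exp (- M s0)) (f s0)" if "s \<in> K" for s
    using that K(2) by blast
  show thesis
  proof
    show "smooth_on K (\<lambda>s. M s - M s0)" by (intro smooth_intros op M)
    show "f s = cmul (exp (M s - M s0)) (f s0)" if "s \<in> K" for s
    proof -
      have "f s = cmul (exp (M s)) (cmul (exp (- M s)) (f s))"
        by (simp add: cmul_cmul exp_minus_inverse cmul_one)
      also have "\<dots> = cmul (exp (M s - M s0)) (f s0)"
        by (simp add: const[OF that] cmul_cmul mult_exp_exp)
      finally show ?thesis .
    qed
  qed
qed

lemma smooth_logarithm:
  fixes f :: "real \<Rightarrow> complex"
  assumes K: "open_interval K" "s0 \<in> K" and f: "smooth_on K f" "\<And>s. s \<in> K \<Longrightarrow> f s \<noteq> 0"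
  obtains B where "smooth_on K B" "\<And>s. s \<in> K \<Longrightarrow> f s = exp (B s)"
proof -
  have op: "open K" using K by (simp add: open_interval_def)
  have "smooth_on K (\<lambda>s. vd f s / f s)"
    by (intro smooth_intros op f smooth_on_vd)
  moreover have "((\<lambda>s. (f s, 0)) has_vector_derivative cmul (vd f s / f s) (f s, 0)) (at s)"
    if "s \<in> K" for s
    using has_vector_derivative_Pair[OF has_vector_derivative_vd[OF op f(1) that]
        has_vector_derivative_const[of 0]]
      f(2)[OF that] by (simp add: cmul_def)
  ultimately obtain B where B: "smooth_on K B"
    "\<And>s. s \<in> K \<Longrightarrow> (f s, 0) = cmul (exp (B s)) (f s0, 0)"
    using exponential_factor[OF K, of "\<lambda>s. vd f s / f s" "\<lambda>s. (f s, 0)"] by blast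
  show thesis
  proof
    show "smooth_on K (\<lambda>s. B s + Ln (f s0))" by (intro smooth_intros op B)
    show "f s = exp (B s + Ln (f s0))" if "s \<in> K" for s
      using B(2)[OF that] f(2)[OF K(2)] by (simp add: cmul_def exp_add)
  qed
qed

text \<open>
  Where \<open>p \<noteq> 0\<close>, both \<open>q\<close> and \<open>q'\<close> are orthogonal to \<open>p\<close> and hence parallel.  By continuity this
  persists at the zeros of \<open>p\<close> if they contain no interval, so \<open>q\<close> spans a fixed complex line
  and \<open>p\<close> lies in the orthogonal one.  If \<open>p\<close> vanished on an interval, \<open>q\<close> could turn freely there.
\<close>

lemma fixed_lines:
  assumes K: "open_interval K" "s0 \<in> K" and L: "lagrangian_circles K p q V"
    and q: "\<And>s. s \<in> K \<Longrightarrow> q s \<noteq> 0"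
    and dense: "\<And>T. open T \<Longrightarrow> T \<subseteq> K \<Longrightarrow> T \<noteq> {} \<Longrightarrow> \<exists>s\<in>T. p s \<noteq> 0"
  obtains U where "unitary U" "\<And>s. s \<in> K \<Longrightarrow> snd (U (p s)) = 0" "\<And>s. s \<in> K \<Longrightarrow> fst (U (q s)) = 0"
proof -
  have op: "open K" using K by (simp add: open_interval_def)
  have sm: "smooth_on K q" and pq: "\<And>s. s \<in> K \<Longrightarrow> herm (p s) (q s) = 0"
    "\<And>s. s \<in> K \<Longrightarrow> herm (p s) (vd q s) = 0"
    using L by (auto simp: lagrangian_circles_def)
  \<comment> \<open>The determinant of \<open>q\<close> and \<open>q'\<close>.\<close>
  define g where "g = (\<lambda>s. fst (q s) * snd (vd q s) - snd (q s) * fst (vd q s))"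
  have "continuous_on K g"
    unfolding g_def
    by (intro smooth_on_imp_continuous_on[OF op] smooth_intros op sm smooth_on_vd)
  then have "open (K \<inter> g -` (- {0}))"
    using op by (intro continuous_open_preimage) auto
  moreover have "g s = 0" if "s \<in> K" "p s \<noteq> 0" for s
  proof -
    have "herm (q s) (p s) = 0" "herm (vd q s) (p s) = 0"
      using pq[OF that(1)] by (metis cnj_herm complex_cnj_zero)+
    from parallel_if_orthogonal[OF this that(2)] show ?thesis by (simp add: g_def)
  qed
  ultimately have "K \<inter> g -` (- {0}) = {}"
    using dense[of "K \<inter> g -` (- {0})"] by blast
  then have g: "fst (q s) * snd (vd q s) = snd (q s) * fst (vd q s)" if "s \<in> K" for s
    using that by (auto simp: g_def)
  define \<mu> where "\<mu> = (\<lambda>s. herm (vd q s) (q s) / herm (q s) (q s))"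
  have nz: "herm (q s) (q s) \<noteq> 0" if "s \<in> K" for s
    using q[OF that] by (simp add: herm_self_eq_0_iff)
  have sm\<mu>: "smooth_on K \<mu>"
    unfolding \<mu>_def by (intro smooth_intros op sm smooth_on_vd nz)
  have "(q has_vector_derivative cmul (\<mu> s) (q s)) (at s)" if "s \<in> K" for s
  proof -
    have "herm (vd q s) (q s) * fst (q s) = herm (q s) (q s) * fst (vd q s)"
      "herm (vd q s) (q s) * snd (q s) = herm (q s) (q s) * snd (vd q s)"
      using g[OF that] unfolding herm_def by algebra+
    then have "cmul (\<mu> s) (q s) = vd q s"
      using nz[OF that] by (simp add: \<mu>_def cmul_def prod_eq_iff field_simps)
    then show ?thesis using has_vector_derivative_vd[OF op sm that] by simp
  qed
  then obtain B where B: "\<And>s. s \<in> K \<Longrightarrow> q s = cmul (exp (B s)) (q s0)"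
    using exponential_factor[OF K sm\<mu>] by blast
  define u where "u = (1 / norm (q s0)) *\<^sub>R q s0"
  have u: "norm u = 1" using q[OF K(2)] by (simp add: u_def)
  have q_u: "q s = cmul (exp (B s) * of_real (norm (q s0))) u" if "s \<in> K" for s
    using B[OF that] q[OF K(2)] by (simp add: u_def cmul_scaleR_right)
      (simp add: cmul_def scaleR_conv_of_real prod_eq_iff)
  show thesis
  proof
    show "unitary (\<lambda>v. (herm v (perp u), herm v u))" by (rule unitary_rows(2)[OF u])
    show "snd (herm (p s) (perp u), herm (p s) u) = 0" if "s \<in> K" for s
      using pq(1)[OF that] q[OF K(2)] unfolding q_u[OF that] herm_cmul_right by simp
    show "fst (herm (q s) (perp u), herm (q s) u) = 0" if "s \<in> K" for s
      unfolding q_u[OF that] herm_cmul_left by simp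
  qed
qed

lemma vd_unitary:
  assumes "open K" "smooth_on K f" "s \<in> K" "unitary U"
  shows "vd (\<lambda>s. U (f s)) s = U (vd f s)"
  using bounded_linear.has_vector_derivative[OF unitary_bounded_linear[OF assms(4)]
      has_vector_derivative_vd[OF assms(1-3)]] by (rule vector_derivative_at)

lemma lagrangian_circles_unitary:
  assumes "open K" "lagrangian_circles K p q V" "unitary U"
  shows "lagrangian_circles K (\<lambda>s. U (p s)) (\<lambda>s. U (q s)) (\<lambda>s. U (V s))"
  using assms smooth_on_linear[OF assms(1) unitary_bounded_linear[OF assms(3)]]
  by (simp add: lagrangian_circles_def vd_unitary unitary_herm)

lemma circle_family_unitary:
  "unitary U \<Longrightarrow>
    U (circle_family p q V s t) = circle_family (\<lambda>s. U (p s)) (\<lambda>s. U (q s)) (\<lambda>s. U (V s)) s t"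
  by (simp add: circle_family_def unitary_add unitary_cmul)

section \<open>Reduction to the normal forms\<close>

text \<open>
  Rotating the circles by an angle \<open>\<theta>\<close> depending on \<open>s\<close> changes \<open>p\<close> and \<open>q\<close> by opposite phases.
  In the last two normal forms \<open>\<theta>\<close> is found by integration, so as to make the curve Legendrian.
\<close>

lemma has_vector_derivative_phase:
  assumes \<theta>: "(\<theta> has_vector_derivative \<theta>') (at s)" and f: "(f has_vector_derivative f') (at s)"
  shows "((\<lambda>s. cis (\<theta> s) * f s) has_vector_derivative cis (\<theta> s) * (f' + \<i> * of_real \<theta>' * f s)) (at s)"
proof -
  have "(cis has_vector_derivative \<i> * cis (\<theta> s)) (at (\<theta> s))"
    unfolding has_vector_derivative_def
    by (rule has_derivative_eq_rhs[OF has_derivative_cis[OF has_derivative_ident]]) auto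
  from vector_diff_chain_at[OF \<theta> this]
  have "((\<lambda>s. cis (\<theta> s)) has_vector_derivative \<theta>' *\<^sub>R (\<i> * cis (\<theta> s))) (at s)"
    by (simp add: o_def)
  from has_vector_derivative_mult[OF this f] show ?thesis
    by (simp add: algebra_simps scaleR_conv_of_real)
qed

text \<open>
  When \<open>p\<close> and \<open>q\<close> have equal length and lie on the two coordinate axes, half the sum of their
  arguments is the common phase \<open>\<phi>\<close>, and half the difference is a rotation of the circle.  The unitary
  map \<open>M\<close> takes the axes to the directions \<open>(1, -\<i>)\<close> and \<open>(1, \<i>)\<close>, in which the circle becomes real up
  to the phase.
\<close>

lemma reduce_to_map_I:
  assumes K: "open_interval K" "s0 \<in> K" and L: "lagrangian_circles K p q V"
    and lines: "\<And>s. s \<in> K \<Longrightarrow> snd (p s) = 0" "\<And>s. s \<in> K \<Longrightarrow> fst (q s) = 0"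
    and norms: "\<And>s. s \<in> K \<Longrightarrow> norm (p s) = norm (q s)" "\<And>s. s \<in> K \<Longrightarrow> q s \<noteq> 0"
  obtains U b \<theta> r \<phi> W1 W2 where "unitary U" "smooth_on K \<theta>" "smooth_on K r" "\<And>s. s \<in> K \<Longrightarrow> r s > 0"
    "smooth_on K \<phi>" "smooth_on K W1" "smooth_on K W2"
    "\<And>s t. s \<in> K \<Longrightarrow> U (circle_family p q V s t) + b = map_I s0 r \<phi> W1 W2 s (t + \<theta> s)"
proof -
  have op: "open K" using K by (simp add: open_interval_def)
  have sm: "smooth_on K p" "smooth_on K q" "smooth_on K V"
    and V: "\<And>s. s \<in> K \<Longrightarrow> herm (vd V s) (q s) = herm (p s) (vd V s)"
    using L by (auto simp: lagrangian_circles_def)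
  have "fst (p s) \<noteq> 0" "snd (q s) \<noteq> 0" if "s \<in> K" for s
    using lines[OF that] norms[OF that] by (auto simp: norm_prod_def prod_eq_iff)
  then obtain B1 B2 where B: "smooth_on K B1" "\<And>s. s \<in> K \<Longrightarrow> fst (p s) = exp (B1 s)"
    "smooth_on K B2" "\<And>s. s \<in> K \<Longrightarrow> snd (q s) = exp (B2 s)"
    using smooth_logarithm[OF K smooth_on_fst[OF op sm(1)]]
      smooth_logarithm[OF K smooth_on_snd[OF op sm(2)]] by metis
  have Re_eq: "Re (B1 s) = Re (B2 s)" if "s \<in> K" for s
    using norms(1)[OF that] lines[OF that] B(2,4)[OF that]
    by (simp add: norm_prod_def)
  define \<phi> \<theta> where "\<phi> = (\<lambda>s. (Im (B1 s) + Im (B2 s)) / 2)" and "\<theta> = (\<lambda>s. (Im (B1 s) - Im (B2 s)) / 2)"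
  define \<rho> where "\<rho> = (\<lambda>s. exp (Re (B1 s)))"
  have polar: "exp z = of_real (exp (Re z)) * cis (Im z)" for z by (simp add: exp_eq_polar)
  have p: "p s = (of_real (\<rho> s) * cis (\<phi> s) * cis (\<theta> s), 0)" if "s \<in> K" for s
    using B(2)[OF that] lines(1)[OF that]
    by (simp add: prod_eq_iff polar[of "B1 s"] \<rho>_def \<phi>_def \<theta>_def cis_mult mult.assoc field_simps)
  have q: "q s = (0, of_real (\<rho> s) * cis (\<phi> s) * cis (- \<theta> s))" if "s \<in> K" for s
    using B(4)[OF that] lines(2)[OF that] Re_eq[OF that]
    by (simp add: prod_eq_iff polar[of "B2 s"] \<rho>_def \<phi>_def \<theta>_def cis_mult mult.assoc field_simps)
  define \<kappa> :: complex where "\<kappa> = of_real (sqrt 2 / 2)"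
  define M :: "C2 \<Rightarrow> C2" where "M = (\<lambda>v. (\<kappa> * (fst v + snd v), \<kappa> * \<i> * (snd v - fst v)))"
  have "\<kappa> * cnj \<kappa> = of_real (sqrt 2 / 2 * (sqrt 2 / 2))"
    by (simp only: \<kappa>_def complex_cnj_complex_of_real of_real_mult)
  moreover have "sqrt 2 / 2 * (sqrt 2 / 2) = (1 / 2 :: real)" by simp
  ultimately have \<kappa>: "\<kappa> * cnj \<kappa> * 2 = 1" by simp
  have M: "unitary M"
  proof -
    have "herm (M v) (M w) = \<kappa> * cnj \<kappa> * 2 * herm v w" for v w
      by (simp add: M_def herm_def algebra_simps)
    then have "herm (M v) (M w) = herm v w" for v w unfolding \<kappa> by simp
    moreover have "M (v + w) = M v + M w" "M (cmul z v) = cmul z (M v)" for v w z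
      by (simp_all add: M_def cmul_def algebra_simps)
    ultimately show ?thesis unfolding unitary_def by blast
  qed
  define z where "z = (\<lambda>s. cis (- \<phi> s) * fst (vd V s))"
  define W1 W2 where "W1 = (\<lambda>s. sqrt 2 * Re (z s))" and "W2 = (\<lambda>s. sqrt 2 * Im (z s))"
  have smz: "smooth_on K z" and sm\<phi>: "smooth_on K \<phi>" and sm\<theta>: "smooth_on K \<theta>"
    unfolding z_def \<phi>_def \<theta>_def by (intro smooth_intros op sm B smooth_on_vd; simp)+
  have smW: "smooth_on K W1" "smooth_on K W2"
    unfolding W1_def W2_def by (intro smooth_intros op smz)+
  have dV: "M (vd V s) = cmul (cis (\<phi> s)) (of_real (W1 s), of_real (W2 s))" if "s \<in> K" for s
  proof -
    have v1: "fst (vd V s) = cis (\<phi> s) * z s"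
      by (simp add: z_def cis_mult mult.assoc[symmetric])
    have "snd (vd V s) * (of_real (\<rho> s) * cis (- \<phi> s) * cis (\<theta> s)) =
        of_real (\<rho> s) * cis (\<phi> s) * cis (\<theta> s) * cnj (fst (vd V s))"
      using V[OF that] by (simp add: p[OF that] q[OF that] herm_def cis_cnj)
    then have "snd (vd V s) * cis (- \<phi> s) = cis (\<phi> s) * cnj (fst (vd V s))"
      by (simp add: \<rho>_def)
    then have "snd (vd V s) * (cis (- \<phi> s) * cis (\<phi> s)) =
        cis (\<phi> s) * (cis (\<phi> s) * cnj (cis (\<phi> s))) * cnj (z s)"
      by (simp add: v1 mult_ac)
    then have v2: "snd (vd V s) = cis (\<phi> s) * cnj (z s)"
      by (simp add: cis_cnj cis_mult)
    have W: "of_real (W1 s) = \<kappa> * (z s + cnj (z s))" "of_real (W2 s) = \<kappa> * \<i> * (cnj (z s) - z s)"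
      by (simp_all add: W1_def W2_def \<kappa>_def complex_eq_iff)
    show ?thesis
      unfolding M_def v1 v2 cmul_def W by (simp add: algebra_simps)
  qed
  define r where "r = (\<lambda>s. sqrt 2 * Re (exp (of_real (Re (B1 s)))))"
  have r: "smooth_on K r" unfolding r_def by (intro smooth_intros op B)
  have r_\<rho>: "r s = sqrt 2 * \<rho> s" for s by (simp add: r_def \<rho>_def exp_of_real)
  show thesis
  proof
    show "unitary M" "smooth_on K \<theta>" "smooth_on K r" "smooth_on K \<phi>" "smooth_on K W1" "smooth_on K W2"
      by fact+
    show "r s > 0" for s by (simp add: r_\<rho> \<rho>_def)
    show "M (circle_family p q V s t) + - M (V s0) = map_I s0 r \<phi> W1 W2 s (t + \<theta> s)"
      if s: "s \<in> K" for s t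
    proof -
      have "(LBINT u=s0..s. cmul (cis (\<phi> u)) (of_real (W1 u), of_real (W2 u))) = M (V s) - M (V s0)"
      proof (rule LBINT_eq_diff[OF K s])
        show "continuous_on K (\<lambda>u. cmul (cis (\<phi> u)) (of_real (W1 u), of_real (W2 u)))"
          by (intro smooth_on_imp_continuous_on[OF op] smooth_intros op sm\<phi> smW)
        show "((\<lambda>s. M (V s)) has_vector_derivative cmul (cis (\<phi> u)) (of_real (W1 u), of_real (W2 u))) (at u)"
          if "u \<in> K" for u
          unfolding dV[OF that, symmetric]
          by (intro bounded_linear.has_vector_derivative[OF unitary_bounded_linear[OF M]]
              has_vector_derivative_vd[OF op sm(3) that])
      qed
      moreover have "M (cmul (cis t) (p s)) + M (cmul (cis (- t)) (q s)) =
          cmul (of_real (sqrt 2 * \<rho> s) * cis (\<phi> s)) (of_real (cos (t + \<theta> s)), of_real (sin (t + \<theta> s)))"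
      proof -
        define \<tau> where "\<tau> = t + \<theta> s"
        have "cmul (cis t) (p s) = cmul (of_real (\<rho> s) * cis (\<phi> s)) (cis \<tau>, 0)"
          "cmul (cis (- t)) (q s) = cmul (of_real (\<rho> s) * cis (\<phi> s)) (0, cis (- \<tau>))"
          by (simp_all add: p[OF s] q[OF s] cmul_def \<tau>_def mult_ac cis_mult)
        then have "M (cmul (cis t) (p s)) + M (cmul (cis (- t)) (q s)) =
          cmul (of_real (\<rho> s) * cis (\<phi> s)) (M (cis \<tau>, 0) + M (0, cis (- \<tau>)))"
          by (simp add: unitary_cmul[OF M] cmul_add_right)
        also have "M (cis \<tau>, 0) + M (0, cis (- \<tau>)) = sqrt 2 *\<^sub>R (of_real (cos \<tau>), of_real (sin \<tau>))"
          by (simp add: M_def \<kappa>_def complex_eq_iff scaleR_conv_of_real)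
        finally show ?thesis unfolding \<tau>_def
          by (simp add: cmul_def scaleR_conv_of_real mult_ac)
      qed
      ultimately show ?thesis
        by (simp add: map_I_def circle_family_def unitary_add[OF M] r_\<rho>)
    qed
  qed
qed

text \<open>
  For \<open>\<gamma>\<close> to be Legendrian means that \<open>\<gamma>'\<close> has no component along \<open>J \<gamma>\<close>; the angular velocity \<open>\<omega>\<close> of
  the rotation is chosen to cancel the component of \<open>p'\<close> along \<open>J p\<close>.  As \<open>q = 0\<close>, the equation for
  the velocity of the centres makes it orthogonal to \<open>\<gamma>\<close>, that is, a multiple of \<open>perp \<gamma>\<close>.
\<close>

lemma reduce_to_map_II:
  assumes K: "open_interval K" "s0 \<in> K" and L: "lagrangian_circles K p q V"
    and q: "\<And>s. s \<in> K \<Longrightarrow> q s = 0" and norms: "\<And>s. s \<in> K \<Longrightarrow> norm (p s) = c" "c > 0"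
  obtains b \<theta> \<gamma> W where "smooth_on K \<theta>" "legendrian_sphere K \<gamma>" "smooth_on K W"
    "\<And>s t. s \<in> K \<Longrightarrow> circle_family p q V s t + b = map_II s0 c \<gamma> W s (t + \<theta> s)"
proof -
  have op: "open K" using K by (simp add: open_interval_def)
  have sm: "smooth_on K p" "smooth_on K q" "smooth_on K V"
    and V: "\<And>s. s \<in> K \<Longrightarrow> herm (p s) (vd V s) = 0"
    using L q by (auto simp: lagrangian_circles_def herm_zero_right)
  have pp: "herm (p s) (p s) = of_real (c\<^sup>2)" if "s \<in> K" for s
    using norms(1)[OF that] by (simp add: herm_self)
  define \<omega> where "\<omega> = (\<lambda>s. Im (herm (vd p s) (p s)) / c\<^sup>2)"
  have "smooth_on K \<omega>"
    unfolding \<omega>_def using norms(2) by (intro smooth_intros op sm smooth_on_vd) simp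
  from smooth_antiderivative[OF K(1) this] obtain \<theta> where \<theta>: "smooth_on K \<theta>"
    "\<And>s. s \<in> K \<Longrightarrow> (\<theta> has_vector_derivative \<omega> s) (at s)" by blast
  define \<gamma> where "\<gamma> = (\<lambda>s. cmul (of_real (1 / c) * cis (- \<theta> s)) (p s))"
  define W where "W = (\<lambda>s. herm (vd V s) (perp (\<gamma> s)))"
  have sm\<gamma>: "smooth_on K \<gamma>" unfolding \<gamma>_def by (intro smooth_intros op sm \<theta>)
  have smW: "smooth_on K W"
    unfolding W_def perp_def by (intro smooth_intros op sm sm\<gamma> smooth_on_vd)
  have cis1: "cis x * cnj (cis x) = 1" for x by (simp add: cis_cnj cis_mult)
  have n\<gamma>: "norm (\<gamma> s) = 1" if "s \<in> K" for s
  proof -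
    have "herm (\<gamma> s) (\<gamma> s) = (cis (- \<theta> s) * cnj (cis (- \<theta> s))) * of_real (1 / c * (1 / c) * c\<^sup>2)"
      unfolding \<gamma>_def herm_cmul_left herm_cmul_right pp[OF that] by simp
    also have "\<dots> = 1" using norms(2) unfolding cis1 by (simp add: power2_eq_square)
    finally have "(norm (\<gamma> s))\<^sup>2 = 1" unfolding herm_self by (simp only: of_real_eq_1_iff)
    then show ?thesis by (simp add: power2_eq_1_iff) (smt (verit) norm_ge_zero)
  qed
  have leg: "vd \<gamma> s \<bullet> J (\<gamma> s) = 0" if "s \<in> K" for s
  proof -
    have "((\<lambda>s. of_real (1 / c) * cis (- \<theta> s)) has_vector_derivative
        of_real (1 / c) * (cis (- \<theta> s) * (0 + \<i> * of_real (- \<omega> s) * 1))) (at s)"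
      using has_vector_derivative_mult_right[OF has_vector_derivative_phase[OF
          has_vector_derivative_minus[OF \<theta>(2)[OF that]] has_vector_derivative_const[of 1]],
          of "of_real (1 / c)"]
      by simp
    from bounded_bilinear.has_vector_derivative[OF bounded_bilinear_cmul this
        has_vector_derivative_vd[OF op sm(1) that]]
    have "vd \<gamma> s = cmul (of_real (1 / c) * cis (- \<theta> s)) (vd p s + cmul (- \<i> * of_real (\<omega> s)) (p s))"
      unfolding \<gamma>_def
      by (subst vector_derivative_at, assumption) (simp add: cmul_def prod_eq_iff algebra_simps)
    then have "herm (vd \<gamma> s) (\<gamma> s) = (cis (- \<theta> s) * cnj (cis (- \<theta> s))) * of_real (1 / c * (1 / c)) *
        (herm (vd p s) (p s) - \<i> * of_real (\<omega> s) * of_real (c\<^sup>2))"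
      by (simp add: \<gamma>_def herm_simps pp[OF that])
    also have "\<dots> = of_real (1 / c * (1 / c)) *
        (herm (vd p s) (p s) - \<i> * of_real (Im (herm (vd p s) (p s))))"
      unfolding cis1 using norms(2) by (simp add: \<omega>_def)
    finally have "Im (herm (vd \<gamma> s) (\<gamma> s)) = 0" by simp
    then show ?thesis by (simp add: inner_eq_Re_herm herm_simps)
  qed
  have dV: "vd V s = cmul (W s) (perp (\<gamma> s))" if "s \<in> K" for s
  proof -
    have "herm (\<gamma> s) (vd V s) = 0" by (simp add: \<gamma>_def herm_simps V[OF that])
    then have "herm (vd V s) (\<gamma> s) = 0" by (metis cnj_herm complex_cnj_zero)
    then show ?thesis
      using orthonormal_expansion[OF n\<gamma>[OF that], of "vd V s"]
      by (simp add: W_def cmul_def zero_prod_def)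
  qed
  show thesis
  proof
    show "smooth_on K \<theta>" "smooth_on K W" by fact+
    show "legendrian_sphere K \<gamma>" using sm\<gamma> n\<gamma> leg by (simp add: legendrian_sphere_def)
    show "circle_family p q V s t + - V s0 = map_II s0 c \<gamma> W s (t + \<theta> s)" if s: "s \<in> K" for s t
    proof -
      have "(LBINT u=s0..s. cmul (W u) (perp (\<gamma> u))) = V s - V s0"
      proof (rule LBINT_eq_diff[OF K s])
        show "continuous_on K (\<lambda>u. cmul (W u) (perp (\<gamma> u)))"
          unfolding perp_def by (intro smooth_on_imp_continuous_on[OF op] smooth_intros op smW sm\<gamma>)
        show "(V has_vector_derivative cmul (W u) (perp (\<gamma> u))) (at u)" if "u \<in> K" for u
          unfolding dV[OF that, symmetric] by (rule has_vector_derivative_vd[OF op sm(3) that])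
      qed
      moreover have "cmul (cis (t + \<theta> s)) (c *\<^sub>R \<gamma> s) = cmul (cis t) (p s)"
      proof -
        have "cmul (cis (t + \<theta> s)) (c *\<^sub>R \<gamma> s) =
            cmul (of_real (c * (1 / c)) * (cis (t + \<theta> s) * cis (- \<theta> s))) (p s)"
          by (simp add: \<gamma>_def cmul_def prod_eq_iff scaleR_conv_of_real mult_ac)
        then show ?thesis using norms(2) by (simp add: cis_mult)
      qed
      ultimately show ?thesis
        unfolding map_II_eq_circle_family by (simp add: circle_family_def q[OF s] cmul_zero_right)
    qed
  qed
qed

text \<open>
  The two components \<open>x\<close> and \<open>y\<close> rotate in opposite directions, so the Legendrian defect changes at
  the rate \<open>|x|\<^sup>2 + |y|\<^sup>2\<close> in the angular velocity.  This is positive, and \<open>\<omega>\<close> can be solved for.  The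
  function \<open>W\<close> is read off from the first component of the velocity of the centres, and the Lagrangian
  equation then determines the second.
\<close>

lemma reduce_to_map_III:
  assumes K: "open_interval K" "s0 \<in> K" and L: "lagrangian_circles K p q V"
    and lines: "\<And>s. s \<in> K \<Longrightarrow> snd (p s) = 0" "\<And>s. s \<in> K \<Longrightarrow> fst (q s) = 0"
    and norms: "\<And>s. s \<in> K \<Longrightarrow> (norm (q s))\<^sup>2 - (norm (p s))\<^sup>2 = c\<^sup>2" "c > 0"
  obtains b \<theta> \<alpha> W where "smooth_on K \<theta>" "legendrian_adS K \<alpha>" "smooth_on K W"
    "\<And>s t. s \<in> K \<Longrightarrow> circle_family p q V s t + b = map_III s0 c \<alpha> W s (t + \<theta> s)"
proof -
  have op: "open K" using K by (simp add: open_interval_def)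
  have sm: "smooth_on K p" "smooth_on K q" "smooth_on K V"
    and V: "\<And>s. s \<in> K \<Longrightarrow> herm (vd V s) (q s) = herm (p s) (vd V s)"
    using L by (auto simp: lagrangian_circles_def)
  define x y where "x = (\<lambda>s. fst (p s))" and "y = (\<lambda>s. snd (q s))"
  have pq: "p s = (x s, 0)" "q s = (0, y s)" if "s \<in> K" for s
    using lines[OF that] by (simp_all add: x_def y_def prod_eq_iff)
  have smxy: "smooth_on K x" "smooth_on K y"
    unfolding x_def y_def by (intro smooth_intros op sm)+
  have xy: "(cmod (y s))\<^sup>2 - (cmod (x s))\<^sup>2 = c\<^sup>2" if "s \<in> K" for s
    using norms(1)[OF that] by (simp add: pq[OF that])
  have y: "y s \<noteq> 0" if "s \<in> K" for s
  proof
    assume "y s = 0"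
    then have "- (cmod (x s))\<^sup>2 = c\<^sup>2" using xy[OF that] by simp
    moreover have "c\<^sup>2 > 0" using norms(2) by simp
    ultimately show False using zero_le_power2[of "cmod (x s)"] by linarith
  qed
  have xx: "(cmod z)\<^sup>2 = Re (z * cnj z)" for z by (simp add: cmod_power2) (simp add: power2_eq_square)
  have sum: "Re (x s * cnj (x s)) + Re (y s * cnj (y s)) > 0" if "s \<in> K" for s
    unfolding xx[symmetric] using y[OF that] by (simp add: add_nonneg_pos)
  define \<omega> where "\<omega> = (\<lambda>s. (Im (vd x s * cnj (x s)) - Im (vd y s * cnj (y s))) /
      (Re (x s * cnj (x s)) + Re (y s * cnj (y s))))"
  have "smooth_on K \<omega>"
    unfolding \<omega>_def
    by (intro smooth_intros op smxy smooth_on_vd; use sum in \<open>metis less_irrefl\<close>)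
  from smooth_antiderivative[OF K(1) this] obtain \<theta> where \<theta>: "smooth_on K \<theta>"
    "\<And>s. s \<in> K \<Longrightarrow> (\<theta> has_vector_derivative \<omega> s) (at s)" by blast
  define \<alpha> where "\<alpha> = (\<lambda>s. (1 / c) *\<^sub>R (cis (- \<theta> s) * x s, cis (\<theta> s) * y s))"
  define W where "W = (\<lambda>s. of_real (c\<^sup>2) * fst (vd V s) / (y s * cnj (y s)))"
  have sm\<alpha>: "smooth_on K \<alpha>" unfolding \<alpha>_def by (intro smooth_intros op smxy \<theta>)
  have smW: "smooth_on K W"
    unfolding W_def using y by (intro smooth_intros op sm smxy smooth_on_vd) auto
  have cis1: "cis x * cnj (cis x) = 1" for x by (simp add: cis_cnj cis_mult)
  have norm_\<alpha>: "(cmod (fst (\<alpha> s)))\<^sup>2 = (cmod (x s))\<^sup>2 / c\<^sup>2" "(cmod (snd (\<alpha> s)))\<^sup>2 = (cmod (y s))\<^sup>2 / c\<^sup>2" for s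
    by (simp_all add: \<alpha>_def norm_mult norm_divide power_mult_distrib power_divide)
  have ads: "(cmod (fst (\<alpha> s)))\<^sup>2 - (cmod (snd (\<alpha> s)))\<^sup>2 = -1" if "s \<in> K" for s
    unfolding norm_\<alpha> using xy[OF that] norms(2) by (simp add: field_simps)
  have leg: "fst (vd \<alpha> s) \<bullet> (\<i> * fst (\<alpha> s)) - snd (vd \<alpha> s) \<bullet> (\<i> * snd (\<alpha> s)) = 0" if "s \<in> K" for s
  proof -
    have "(\<alpha> has_vector_derivative (1 / c) *\<^sub>R (cis (- \<theta> s) * (vd x s + \<i> * of_real (- \<omega> s) * x s),
        cis (\<theta> s) * (vd y s + \<i> * of_real (\<omega> s) * y s))) (at s)"
      unfolding \<alpha>_def
      by (intro bounded_linear.has_vector_derivative[OF bounded_linear_scaleR_right]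
          has_vector_derivative_Pair has_vector_derivative_phase has_vector_derivative_minus
          \<theta> that has_vector_derivative_vd[OF op] smxy)
    from vector_derivative_at[OF this]
    have d: "fst (vd \<alpha> s) = of_real (1 / c) * (cis (- \<theta> s) * (vd x s - \<i> * of_real (\<omega> s) * x s))"
      "snd (vd \<alpha> s) = of_real (1 / c) * (cis (\<theta> s) * (vd y s + \<i> * of_real (\<omega> s) * y s))"
      by (simp_all add: scaleR_conv_of_real)
    have im: "v \<bullet> (\<i> * w) = Im (v * cnj w)" for v w :: complex
      by (simp add: inner_complex_def)
    have "fst (vd \<alpha> s) * cnj (fst (\<alpha> s)) = (cis (- \<theta> s) * cnj (cis (- \<theta> s))) * of_real (1 / c * (1 / c)) *
        (vd x s * cnj (x s) - \<i> * of_real (\<omega> s) * (x s * cnj (x s)))"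
      unfolding d by (simp add: \<alpha>_def scaleR_conv_of_real algebra_simps)
    then have 1: "Im (fst (vd \<alpha> s) * cnj (fst (\<alpha> s))) = (1 / c * (1 / c)) *
        (Im (vd x s * cnj (x s)) - \<omega> s * Re (x s * cnj (x s)))"
      unfolding cis1 by simp
    have "snd (vd \<alpha> s) * cnj (snd (\<alpha> s)) = (cis (\<theta> s) * cnj (cis (\<theta> s))) * of_real (1 / c * (1 / c)) *
        (vd y s * cnj (y s) + \<i> * of_real (\<omega> s) * (y s * cnj (y s)))"
      unfolding d by (simp add: \<alpha>_def scaleR_conv_of_real algebra_simps)
    then have 2: "Im (snd (vd \<alpha> s) * cnj (snd (\<alpha> s))) = (1 / c * (1 / c)) *
        (Im (vd y s * cnj (y s)) + \<omega> s * Re (y s * cnj (y s)))"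
      unfolding cis1 by simp
    have "\<omega> s * (Re (x s * cnj (x s)) + Re (y s * cnj (y s))) =
        Im (vd x s * cnj (x s)) - Im (vd y s * cnj (y s))"
      by (simp only: \<omega>_def times_divide_eq_left
          nonzero_mult_div_cancel_right[OF less_imp_neq[OF sum[OF that], symmetric]])
    then have "Im (vd x s * cnj (x s)) - \<omega> s * Re (x s * cnj (x s)) =
        Im (vd y s * cnj (y s)) + \<omega> s * Re (y s * cnj (y s))"
      by (simp only: distrib_left)
    then show ?thesis unfolding im 1 2 by simp
  qed
  have dV: "vd V s = (W s * of_real ((cmod (snd (\<alpha> s)))\<^sup>2), cnj (W s) * fst (\<alpha> s) * snd (\<alpha> s))"
    if s: "s \<in> K" for s
  proof -
    have v: "snd (vd V s) * cnj (y s) = x s * cnj (fst (vd V s))"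
      using V[OF s] by (simp add: pq[OF s] herm_def)
    have "of_real ((cmod (snd (\<alpha> s)))\<^sup>2) = y s * cnj (y s) / of_real (c\<^sup>2)"
      unfolding norm_\<alpha> by (simp only: of_real_divide complex_norm_square)
    then have 1: "W s * of_real ((cmod (snd (\<alpha> s)))\<^sup>2) = fst (vd V s)"
      using y[OF s] norms(2) by (simp add: W_def)
    have "fst (\<alpha> s) * snd (\<alpha> s) = (cis (- \<theta> s) * cis (\<theta> s)) * (x s * y s) / of_real (c\<^sup>2)"
      by (simp add: \<alpha>_def scaleR_conv_of_real power2_eq_square)
    then have "fst (\<alpha> s) * snd (\<alpha> s) = x s * y s / of_real (c\<^sup>2)"
      by (simp add: cis_mult)
    then have "cnj (W s) * fst (\<alpha> s) * snd (\<alpha> s) = cnj (W s) * (x s * y s / of_real (c\<^sup>2))"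
      by (simp only: mult.assoc)
    also have "\<dots> = x s * cnj (fst (vd V s)) / cnj (y s)"
      using y[OF s] norms(2) by (simp add: W_def)
    also have "\<dots> = snd (vd V s)"
      unfolding v[symmetric] using y[OF s] by simp
    finally show ?thesis using 1 by (simp add: prod_eq_iff)
  qed
  show thesis
  proof
    show "smooth_on K \<theta>" "smooth_on K W" by fact+
    show "legendrian_adS K \<alpha>" using sm\<alpha> ads leg by (simp add: legendrian_adS_def)
    show "circle_family p q V s t + - V s0 = map_III s0 c \<alpha> W s (t + \<theta> s)" if s: "s \<in> K" for s t
    proof -
      have "(LBINT u=s0..s. (W u * of_real ((cmod (snd (\<alpha> u)))\<^sup>2), cnj (W u) * fst (\<alpha> u) * snd (\<alpha> u)))
          = V s - V s0"
      proof (rule LBINT_eq_diff[OF K s])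
        show "continuous_on K (\<lambda>u.
            (W u * of_real ((cmod (snd (\<alpha> u)))\<^sup>2), cnj (W u) * fst (\<alpha> u) * snd (\<alpha> u)))"
          unfolding complex_norm_square
          by (intro smooth_on_imp_continuous_on[OF op] smooth_intros op smW sm\<alpha>)
        show "(V has_vector_derivative
            (W u * of_real ((cmod (snd (\<alpha> u)))\<^sup>2), cnj (W u) * fst (\<alpha> u) * snd (\<alpha> u))) (at u)"
          if "u \<in> K" for u
          unfolding dV[OF that, symmetric] by (rule has_vector_derivative_vd[OF op sm(3) that])
      qed
      moreover have "c *\<^sub>R (fst (\<alpha> s) * cis (t + \<theta> s), snd (\<alpha> s) * cis (- (t + \<theta> s))) =
          (cis t * x s, cis (- t) * y s)"
      proof -
        have "cis (- \<theta> s) * cis (t + \<theta> s) = cis t" "cis (\<theta> s) * cis (- (t + \<theta> s)) = cis (- t)"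
          by (simp_all add: cis_mult)
        then have "cis (- \<theta> s) * x s * cis (t + \<theta> s) = cis t * x s"
          "cis (\<theta> s) * y s * cis (- (t + \<theta> s)) = cis (- t) * y s"
          by (metis mult.assoc mult.commute)+
        then show ?thesis using norms(2) by (simp add: \<alpha>_def)
      qed
      ultimately show ?thesis
        unfolding map_III_def by (simp add: circle_family_def pq[OF s] cmul_def)
    qed
  qed
qed

section \<open>Local classification\<close>

text \<open>
  The two groups of complex circles, with \<open>q = 0\<close> and with \<open>p = 0\<close>, are distinguished by the
  orientation; a complex line contains \<open>p\<close> and \<open>q\<close>, which are orthogonal.
\<close>

lemma complex_circles_iff:
  assumes s: "s \<in> I" and pq: "herm (p s) (q s) = 0"
    and X: "\<And>t. X s t = circle_family p q V s t"
  shows "s \<in> complex_circles I X \<longleftrightarrow> p s = 0 \<or> q s = 0"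
proof
  assume "s \<in> complex_circles I X"
  then obtain a v where "\<forall>t. \<exists>z. X s t = a + cmul z v"
    unfolding complex_circles_def by blast
  then obtain z where z: "X s t = a + cmul (z t) v" for t by metis
  have diff: "X s t - X s t' = cmul (z t - z t') v" for t t'
    by (simp add: z cmul_def algebra_simps)
  \<comment> \<open>Two diameters of the circle, at right angles, recover \<open>p + q\<close> and \<open>p - q\<close> as multiples of \<open>v\<close>.\<close>
  have "cmul 2 (p s + q s) = X s 0 - X s pi"
    by (simp add: X circle_family_real_form cmul_def prod_eq_iff)
  then have 1: "cmul 2 (p s + q s) = cmul (z 0 - z pi) v" by (simp only: diff)
  have "cmul 2 (p s - q s) = cmul (- \<i>) (X s (pi / 2) - X s (- (pi / 2)))"
    by (simp add: X circle_family_real_form cmul_def prod_eq_iff algebra_simps)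
  then have 2: "cmul 2 (p s - q s) = cmul (- \<i> * (z (pi / 2) - z (- (pi / 2)))) v"
    by (simp only: diff cmul_cmul)
  have sum: "p s = cmul (1 / 4) (cmul 2 (p s + q s) + cmul 2 (p s - q s))"
    and diff': "q s = cmul (1 / 4) (cmul 2 (p s + q s) - cmul 2 (p s - q s))"
    by (simp_all add: cmul_def prod_eq_iff)
  have distrib: "cmul x v + cmul y v = cmul (x + y) v" "cmul x v - cmul y v = cmul (x - y) v" for x y
    by (simp_all add: cmul_def algebra_simps)
  obtain a b where "p s = cmul a v" "q s = cmul b v"
    using sum diff' unfolding 1 2 distrib cmul_cmul by blast
  with pq show "p s = 0 \<or> q s = 0"
    by (auto simp: herm_simps herm_self_eq_0_iff cmul_eq_0_iff)
next
  assume "p s = 0 \<or> q s = 0"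
  then have "\<forall>t. \<exists>z. X s t = V s + cmul z (p s + q s)"
    unfolding X circle_family_def by (auto simp: cmul_zero_right add.commute)
  with s show "s \<in> complex_circles I X" unfolding complex_circles_def by blast
qed

definition has_normal_form :: "real set \<Rightarrow> (real \<Rightarrow> real \<Rightarrow> C2) \<Rightarrow> bool" where
  "has_normal_form K X \<longleftrightarrow>
     (\<exists>s0 r \<phi> W1 W2. data_I K s0 r \<phi> W1 W2 \<and> congruent_on K X (map_I s0 r \<phi> W1 W2)) \<or>
     (\<exists>s0 c \<gamma> W. data_II K s0 c \<gamma> W \<and> congruent_on K X (map_II s0 c \<gamma> W)) \<or>
     (\<exists>s0 c \<alpha> W. data_III K s0 c \<alpha> W \<and> congruent_on K X (map_III s0 c \<alpha> W))"

text \<open>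
  The sign \<open>\<sigma>\<close> records the orientation of the circles, so that the roles of \<open>p\<close> and \<open>q\<close> can be
  fixed in advance.
\<close>

lemma congruent_onI:
  assumes X: "\<And>s t. s \<in> K \<Longrightarrow> X s t = circle_family p q V s (\<sigma> * t)" and \<sigma>: "\<sigma> = 1 \<or> \<sigma> = -1"
    and "unitary U" "smooth_on K \<theta>"
    and "\<And>s t. s \<in> K \<Longrightarrow> U (circle_family p q V s t) + b = Y s (t + \<theta> s)"
  shows "congruent_on K X Y"
  unfolding congruent_on_def
  by (rule exI[of _ U], rule exI[of _ b], rule exI[of _ \<theta>], rule exI[of _ \<sigma>]) (simp add: assms)

text \<open>On an interval of complex circles, each with \<open>q = 0\<close>, the radius is constant.\<close>

lemma normal_form_complex_circles:
  assumes K: "open_interval K" "s1 \<in> K" and imm: "immersion_on K X"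
    and L: "lagrangian_circles K p q V" and q: "\<And>s. s \<in> K \<Longrightarrow> q s = 0" and p: "p s1 \<noteq> 0"
    and X: "\<And>s t. s \<in> K \<Longrightarrow> X s t = circle_family p q V s (\<sigma> * t)" and \<sigma>: "\<sigma> = 1 \<or> \<sigma> = -1"
  shows "has_normal_form K X"
proof -
  have op: "open K" using K by (simp add: open_interval_def)
  have norms: "norm (p s) = norm (p s1)" if "s \<in> K" for s
    using norm_difference_constant[OF K(1) L that K(2)] q that K(2) by simp
  obtain b \<theta> \<gamma> W where \<theta>: "smooth_on K \<theta>" and \<gamma>: "legendrian_sphere K \<gamma>" and W: "smooth_on K W"
    and eq: "\<And>s t. s \<in> K \<Longrightarrow> circle_family p q V s t + b = map_II s1 (norm (p s1)) \<gamma> W s (t + \<theta> s)"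
    using reduce_to_map_II[OF K L q norms] p by (metis zero_less_norm_iff)
  have cong: "congruent_on K X (map_II s1 (norm (p s1)) \<gamma> W)"
    by (rule congruent_onI[OF X \<sigma> unitary_id \<theta> eq])
  then have "data_II K s1 (norm (p s1)) \<gamma> W"
    using K \<gamma> W immersion_on_congruent[OF op imm cong] by (simp add: data_II_def)
  with cong show ?thesis unfolding has_normal_form_def by blast
qed

text \<open>
  Away from intervals of complex circles the constant \<open>k\<close> decides between the Lagrangian planes of
  the first normal form and the third one.  The longer of the two vectors, \<open>q\<close>, has no zeros, because
  \<open>|q|\<^sup>2 - |p|\<^sup>2 = k \<ge> 0\<close> and \<open>p\<close>, \<open>q\<close> do not vanish together.  The complex
  circles, where \<open>p = 0\<close>, only have to leave out a dense set of parameters.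
\<close>

lemma normal_form_noncomplex_circles:
  assumes K: "open_interval K" "s1 \<in> K" and imm: "immersion_on K X"
    and L: "lagrangian_circles K p q V" and le: "norm (p s1) \<le> norm (q s1)"
    and nz: "\<And>s. s \<in> K \<Longrightarrow> p s \<noteq> 0 \<or> q s \<noteq> 0"
    and dense: "\<And>T. open T \<Longrightarrow> T \<subseteq> K \<Longrightarrow> T \<noteq> {} \<Longrightarrow> \<exists>s\<in>T. p s \<noteq> 0"
    and X: "\<And>s t. s \<in> K \<Longrightarrow> X s t = circle_family p q V s (\<sigma> * t)" and \<sigma>: "\<sigma> = 1 \<or> \<sigma> = -1"
  shows "has_normal_form K X"
proof -
  have op: "open K" using K by (simp add: open_interval_def)
  define k where "k = (norm (q s1))\<^sup>2 - (norm (p s1))\<^sup>2"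
  have "k \<ge> 0" using le by (simp add: k_def power_mono)
  have k: "(norm (q s))\<^sup>2 - (norm (p s))\<^sup>2 = k" if "s \<in> K" for s
    using norm_difference_constant[OF K(1) L that K(2)] by (simp add: k_def)
  have q: "q s \<noteq> 0" if "s \<in> K" for s
  proof
    assume "q s = 0"
    then have "(norm (q s))\<^sup>2 = 0" by simp
    then have "(norm (p s))\<^sup>2 \<le> 0" using k[OF that] \<open>k \<ge> 0\<close> by linarith
    with \<open>q s = 0\<close> nz[OF that] show False by simp
  qed
  from fixed_lines[OF K L q dense] obtain U where U: "unitary U"
    and lines: "\<And>s. s \<in> K \<Longrightarrow> snd (U (p s)) = 0" "\<And>s. s \<in> K \<Longrightarrow> fst (U (q s)) = 0" by blast
  note L' = lagrangian_circles_unitary[OF op L U]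
  show ?thesis
  proof (cases "k = 0")
    case True
    have "norm (U (p s)) = norm (U (q s))" "U (q s) \<noteq> 0" if "s \<in> K" for s
      using k[OF that] True q[OF that]
      by (simp_all add: unitary_norm[OF U] unitary_eq_0_iff[OF U] power2_eq_iff_nonneg)
    from reduce_to_map_I[OF K L' lines this] obtain U' b \<theta> r \<phi> W1 W2 where U': "unitary U'"
      and sm: "smooth_on K \<theta>" "smooth_on K r" "\<And>s. s \<in> K \<Longrightarrow> r s > 0" "smooth_on K \<phi>"
        "smooth_on K W1" "smooth_on K W2"
      and eq: "\<And>s t. s \<in> K \<Longrightarrow> U' (circle_family (\<lambda>s. U (p s)) (\<lambda>s. U (q s)) (\<lambda>s. U (V s)) s t) + b
        = map_I s1 r \<phi> W1 W2 s (t + \<theta> s)" by metis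
    have cong: "congruent_on K X (map_I s1 r \<phi> W1 W2)"
      using eq by (intro congruent_onI[OF X \<sigma> unitary_compose[OF U' U] sm(1)])
        (simp_all add: circle_family_unitary[OF U])
    then have "data_I K s1 r \<phi> W1 W2"
      using K sm immersion_on_congruent[OF op imm cong] by (simp add: data_I_def)
    with cong show ?thesis unfolding has_normal_form_def by blast
  next
    case False
    with \<open>k \<ge> 0\<close> have "sqrt k > 0" by simp
    moreover have "(norm (U (q s)))\<^sup>2 - (norm (U (p s)))\<^sup>2 = (sqrt k)\<^sup>2" if "s \<in> K" for s
      using k[OF that] \<open>k \<ge> 0\<close> by (simp add: unitary_norm[OF U])
    ultimately obtain b \<theta> \<alpha> W where \<theta>: "smooth_on K \<theta>" and \<alpha>: "legendrian_adS K \<alpha>"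
      and W: "smooth_on K W"
      and eq: "\<And>s t. s \<in> K \<Longrightarrow> circle_family (\<lambda>s. U (p s)) (\<lambda>s. U (q s)) (\<lambda>s. U (V s)) s t + b
        = map_III s1 (sqrt k) \<alpha> W s (t + \<theta> s)"
      using reduce_to_map_III[OF K L' lines] by metis
    have cong: "congruent_on K X (map_III s1 (sqrt k) \<alpha> W)"
      using eq by (intro congruent_onI[OF X \<sigma> U \<theta>]) (simp_all add: circle_family_unitary[OF U])
    then have "data_III K s1 (sqrt k) \<alpha> W"
      using K \<alpha> W immersion_on_congruent[OF op imm cong] by (simp add: data_III_def)
    with cong show ?thesis unfolding has_normal_form_def by blast
  qed
qed

lemma generic_open_dense:
  assumes "open I"
  shows "open (generic I X)" "I \<subseteq> closure (generic I X)"
proof -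
  let ?F = "frontier (interior (complex_circles I X))"
  show "open (generic I X)" unfolding generic_def using assms by (simp add: open_Diff)
  \<comment> \<open>The boundary of an open set has no interior.\<close>
  have F: "\<not> T \<subseteq> ?F" if "open T" "T \<noteq> {}" for T
    using that open_Int_closure_eq_empty[OF that(1), of "interior (complex_circles I X)"]
    unfolding frontier_def interior_interior by blast
  show "I \<subseteq> closure (generic I X)"
  proof
    fix s assume s: "s \<in> I"
    show "s \<in> closure (generic I X)"
      unfolding closure_iff_nhds_not_empty
    proof (intro allI impI)
      fix A V assume V: "V \<subseteq> A" "open V" "s \<in> V"
      then have "\<not> V \<inter> I \<subseteq> ?F"
        using assms s by (intro F) auto
      with V show "generic I X \<inter> A \<noteq> {}" unfolding generic_def by blast
    qed
  qed
qed

lemma open_interval_ball: "open_interval (ball (s::real) e)"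
  by (simp add: open_interval_def is_interval_convex_1 convex_ball)

text \<open>
  Near a generic parameter either all circles are complex, or those that are not complex are dense.
  Changing the orientation, if necessary, one may take \<open>q = 0\<close> in the first case and \<open>|p| \<le> |q|\<close> in the
  second.
\<close>

theorem local_classification:
  assumes I: "open_interval I" and X: "cyclic_immersion I X" "lagrangian_on I X"
    and s1: "s1 \<in> generic I X"
  shows "\<exists>K\<subseteq>I. open_interval K \<and> s1 \<in> K \<and> has_normal_form K X"
proof -
  let ?C = "complex_circles I X"
  have op: "open I" using I by (simp add: open_interval_def)
  from cyclic_lagrangian_circles[OF op X] obtain p q V where L: "lagrangian_circles I p q V"
    and eq: "\<And>s t. s \<in> I \<Longrightarrow> X s t = circle_family p q V s t"
    and nz: "\<And>s. s \<in> I \<Longrightarrow> p s \<noteq> 0 \<or> q s \<noteq> 0" by blast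
  have C: "s \<in> ?C \<longleftrightarrow> p s = 0 \<or> q s = 0" if "s \<in> I" for s
    using L eq that by (intro complex_circles_iff) (auto simp: lagrangian_circles_def)
  have CI: "?C \<subseteq> I" by (auto simp: complex_circles_def)
  have s1I: "s1 \<in> I" and s1F: "s1 \<notin> frontier (interior ?C)" using s1 by (auto simp: generic_def)
  have imm: "immersion_on K X" if "K \<subseteq> I" for K
    using X(1) that unfolding cyclic_immersion_def immersion_on_def by blast
  have flip: "X s t = circle_family p q V s (1 * t)" "X s t = circle_family q p V s (- 1 * t)"
    if "s \<in> I" for s t
    using eq[OF that] by (simp_all add: circle_family_flip[of q p])
  show ?thesis
  proof (cases "s1 \<in> interior ?C")
    case True
    then obtain e where e: "e > 0" "ball s1 e \<subseteq> interior ?C"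
      using open_interior open_contains_ball by meson
    define K where "K = ball s1 e"
    have K: "open_interval K" "s1 \<in> K" "K \<subseteq> ?C" "K \<subseteq> I"
      using e interior_subset[of ?C] CI by (auto simp: K_def open_interval_ball)
    note LK = lagrangian_circles_subset[OF L K(4)]
    have diff: "(norm (p s))\<^sup>2 - (norm (q s))\<^sup>2 = (norm (p s1))\<^sup>2 - (norm (q s1))\<^sup>2" if "s \<in> K" for s
      by (rule norm_difference_constant[OF K(1) LK that K(2)])
    have zero: "p s = 0 \<or> q s = 0" if "s \<in> K" for s
      using C[of s] that K by blast
    have "has_normal_form K X"
    proof (cases "p s1 = 0")
      case True
      then have q1: "q s1 \<noteq> 0" using nz[OF s1I] by blast
      have "p s = 0" if "s \<in> K" for s
      proof (rule ccontr)
        assume "p s \<noteq> 0"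
        then have "(norm (p s))\<^sup>2 = - (norm (q s1))\<^sup>2" using zero[OF that] diff[OF that] True by auto
        moreover have "(norm (p s))\<^sup>2 > 0" using \<open>p s \<noteq> 0\<close> by simp
        ultimately show False using zero_le_power2[of "norm (q s1)"] by linarith
      qed
      from normal_form_complex_circles[OF K(1,2) imm[OF K(4)] lagrangian_circles_swap[OF LK] this q1
          flip(2)[OF subsetD[OF K(4)]]]
      show ?thesis by blast
    next
      case False
      then have q1: "q s1 = 0" using zero[OF K(2)] by blast
      have "q s = 0" if "s \<in> K" for s
      proof (rule ccontr)
        assume "q s \<noteq> 0"
        then have "- (norm (q s))\<^sup>2 = (norm (p s1))\<^sup>2" using zero[OF that] diff[OF that] q1 by auto
        moreover have "(norm (q s))\<^sup>2 > 0" using \<open>q s \<noteq> 0\<close> by simp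
        ultimately show False using zero_le_power2[of "norm (p s1)"] by linarith
      qed
      from normal_form_complex_circles[OF K(1,2) imm[OF K(4)] LK this False
          flip(1)[OF subsetD[OF K(4)]]]
      show ?thesis by blast
    qed
    with K show ?thesis by blast
  next
    case False
    with s1F have "s1 \<in> I - closure (interior ?C)"
      using s1I by (simp add: frontier_def)
    moreover have "open (I - closure (interior ?C))" using op by (simp add: open_Diff)
    ultimately obtain e where e: "e > 0" "ball s1 e \<subseteq> I - closure (interior ?C)"
      using open_contains_ball by meson
    define K where "K = ball s1 e"
    have K: "open_interval K" "s1 \<in> K" "K \<subseteq> I" and KC: "K \<inter> interior ?C = {}"
      using e closure_subset[of "interior ?C"] by (auto simp: K_def open_interval_ball)
    note LK = lagrangian_circles_subset[OF L K(3)]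
    have dense: "\<exists>s\<in>T. p s \<noteq> 0 \<and> q s \<noteq> 0" if "open T" "T \<subseteq> K" "T \<noteq> {}" for T
    proof -
      have "\<not> T \<subseteq> ?C" using that KC interior_maximal[of T ?C] by blast
      then obtain s where "s \<in> T" "s \<notin> ?C" by blast
      with C[of s] that(2) K(3) show ?thesis by blast
    qed
    have nzK: "p s \<noteq> 0 \<or> q s \<noteq> 0" "q s \<noteq> 0 \<or> p s \<noteq> 0" if "s \<in> K" for s
      using nz[of s] that K(3) by auto
    have denseK: "\<exists>s\<in>T. p s \<noteq> 0" "\<exists>s\<in>T. q s \<noteq> 0" if "open T" "T \<subseteq> K" "T \<noteq> {}" for T
      using dense[OF that] by auto
    have flipK: "X s t = circle_family p q V s (1 * t)" "X s t = circle_family q p V s (- 1 * t)"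
      if "s \<in> K" for s t
      using flip[OF subsetD[OF K(3) that]] .
    have "has_normal_form K X"
    proof (cases "norm (p s1) \<le> norm (q s1)")
      case True
      show ?thesis
        by (rule normal_form_noncomplex_circles[OF K(1,2) imm[OF K(3)] LK True
              nzK(1) denseK(1) flipK(1)]) auto
    next
      case False
      then have le: "norm (q s1) \<le> norm (p s1)" by simp
      show ?thesis
        by (rule normal_form_noncomplex_circles[OF K(1,2) imm[OF K(3)]
              lagrangian_circles_swap[OF LK] le nzK(2) denseK(2) flipK(2)]) auto
    qed
    with K show ?thesis by blast
  qed
qed

theorem theorem2:
  shows
   "(\<forall>I X. open_interval I \<and> cyclic_immersion I X \<and> lagrangian_on I X \<longrightarrow>
       open (generic I X) \<and> I \<subseteq> closure (generic I X) \<and>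
       (\<forall>s1\<in>generic I X. \<exists>K\<subseteq>I. open_interval K \<and> s1 \<in> K \<and>
          ((\<exists>s0 r \<phi> W1 W2. data_I K s0 r \<phi> W1 W2 \<and> congruent_on K X (map_I s0 r \<phi> W1 W2)) \<or>
           (\<exists>s0 c \<gamma> W. data_II K s0 c \<gamma> W \<and> congruent_on K X (map_II s0 c \<gamma> W)) \<or>
           (\<exists>s0 c \<alpha> W. data_III K s0 c \<alpha> W \<and> congruent_on K X (map_III s0 c \<alpha> W))))) \<and>
    (\<forall>I s0 r \<phi> W1 W2. data_I I s0 r \<phi> W1 W2 \<longrightarrow>
       cyclic_immersion I (map_I s0 r \<phi> W1 W2) \<and> lagrangian_on I (map_I s0 r \<phi> W1 W2)) \<and>
    (\<forall>I s0 c \<gamma> W. data_II I s0 c \<gamma> W \<longrightarrow>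
       cyclic_immersion I (map_II s0 c \<gamma> W) \<and> lagrangian_on I (map_II s0 c \<gamma> W)) \<and>
    (\<forall>I s0 c \<alpha> W. data_III I s0 c \<alpha> W \<longrightarrow>
       cyclic_immersion I (map_III s0 c \<alpha> W) \<and> lagrangian_on I (map_III s0 c \<alpha> W)) \<and>
    (\<forall>I s0 r \<phi> W1 W2 \<phi>0. data_I I s0 r \<phi> W1 W2 \<and> (\<forall>s\<in>I. \<phi> s = \<phi>0) \<longrightarrow>
       lagrangian_plane (span {cmul (cis \<phi>0) (1, 0), cmul (cis \<phi>0) (0, 1)}) \<and>
       (\<forall>s\<in>I. \<forall>t. map_I s0 r \<phi> W1 W2 s t \<in> span {cmul (cis \<phi>0) (1, 0), cmul (cis \<phi>0) (0, 1)})) \<and>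
    (\<forall>I s0 c \<gamma> W \<gamma>0. data_II I s0 c \<gamma> W \<and> (\<forall>s\<in>I. \<gamma> s = \<gamma>0) \<longrightarrow>
       (\<exists>U W' V2. unitary U \<and> U \<gamma>0 = (1, 0) \<and> data_II I s0 c (\<lambda>_. (1, 0)) W' \<and>
          smooth_on I V2 \<and> c \<noteq> 0 \<and>
          (\<forall>s\<in>I. \<forall>t. U (map_II s0 c \<gamma> W s t) = map_II s0 c (\<lambda>_. (1, 0)) W' s t \<and>
                      map_II s0 c (\<lambda>_. (1, 0)) W' s t = (of_real c * cis t, V2 s)) \<and>
          U ` {map_II s0 c \<gamma> W s t |s t. s \<in> I} = sphere 0 \<bar>c\<bar> \<times> V2 ` I))"
proof (intro conjI allI impI)
  fix I X assume X: "open_interval I \<and> cyclic_immersion I X \<and> lagrangian_on I X"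
  then have I: "open I" by (simp add: open_interval_def)
  show "open (generic I X)" "I \<subseteq> closure (generic I X)"
    by (rule generic_open_dense[OF I])+
  show "\<forall>s1\<in>generic I X. \<exists>K\<subseteq>I. open_interval K \<and> s1 \<in> K \<and>
          ((\<exists>s0 r \<phi> W1 W2. data_I K s0 r \<phi> W1 W2 \<and> congruent_on K X (map_I s0 r \<phi> W1 W2)) \<or>
           (\<exists>s0 c \<gamma> W. data_II K s0 c \<gamma> W \<and> congruent_on K X (map_II s0 c \<gamma> W)) \<or>
           (\<exists>s0 c \<alpha> W. data_III K s0 c \<alpha> W \<and> congruent_on K X (map_III s0 c \<alpha> W)))"
    using local_classification[of I X] X unfolding has_normal_form_def by simp
next
  fix I s0 r \<phi> W1 W2 assume data: "data_I I s0 r \<phi> W1 W2"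
  then have I: "open I" and imm: "immersion_on I (map_I s0 r \<phi> W1 W2)"
    by (simp_all add: data_I_def open_interval_def)
  show "cyclic_immersion I (map_I s0 r \<phi> W1 W2)" "lagrangian_on I (map_I s0 r \<phi> W1 W2)"
    using cyclic_lagrangian_if_circles[OF I imm map_I_lagrangian_circles[OF data]
        map_I_eq_circle_family] by simp_all
next
  fix I s0 c \<gamma> W assume data: "data_II I s0 c \<gamma> W"
  then have I: "open I" and imm: "immersion_on I (map_II s0 c \<gamma> W)"
    by (simp_all add: data_II_def open_interval_def)
  show "cyclic_immersion I (map_II s0 c \<gamma> W)" "lagrangian_on I (map_II s0 c \<gamma> W)"
    using cyclic_lagrangian_if_circles[OF I imm map_II_lagrangian_circles[OF data]
        map_II_eq_circle_family] by simp_all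
next
  fix I s0 c \<alpha> W assume data: "data_III I s0 c \<alpha> W"
  then have I: "open I" and imm: "immersion_on I (map_III s0 c \<alpha> W)"
    by (simp_all add: data_III_def open_interval_def)
  show "cyclic_immersion I (map_III s0 c \<alpha> W)" "lagrangian_on I (map_III s0 c \<alpha> W)"
    using cyclic_lagrangian_if_circles[OF I imm map_III_lagrangian_circles[OF data]
        map_III_eq_circle_family] by simp_all
next
  fix I s0 r \<phi> W1 W2 \<phi>0 assume data: "data_I I s0 r \<phi> W1 W2 \<and> (\<forall>s\<in>I. \<phi> s = \<phi>0)"
  show "lagrangian_plane (span {cmul (cis \<phi>0) (1, 0), cmul (cis \<phi>0) (0, 1)})"
    by (rule lagrangian_plane_phase)
  show "\<forall>s\<in>I. \<forall>t. map_I s0 r \<phi> W1 W2 s t \<in> span {cmul (cis \<phi>0) (1, 0), cmul (cis \<phi>0) (0, 1)}"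
    using data map_I_constant_phase by blast
next
  fix I s0 c \<gamma> W \<gamma>0 assume data: "data_II I s0 c \<gamma> W \<and> (\<forall>s\<in>I. \<gamma> s = \<gamma>0)"
  show "\<exists>U W' V2. unitary U \<and> U \<gamma>0 = (1, 0) \<and> data_II I s0 c (\<lambda>_. (1, 0)) W' \<and>
          smooth_on I V2 \<and> c \<noteq> 0 \<and>
          (\<forall>s\<in>I. \<forall>t. U (map_II s0 c \<gamma> W s t) = map_II s0 c (\<lambda>_. (1, 0)) W' s t \<and>
                      map_II s0 c (\<lambda>_. (1, 0)) W' s t = (of_real c * cis t, V2 s)) \<and>
          U ` {map_II s0 c \<gamma> W s t |s t. s \<in> I} = sphere 0 \<bar>c\<bar> \<times> V2 ` I"
    by (rule map_II_constant_curve) (use data in auto)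
qed

end
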